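(* Let $\mathscr E=(E,\mathscr L,\mathscr B)$ be a normal labeled space and let $K$ be a field. Then the Leavitt labeled path algebra $L_K(\mathscr E)$ is graded regular with respect to its $\mathbb Z$-grading, whose homogeneous components are $L_K(\mathscr E)_n=\mathrm{span}_K\{s_\alpha p_As_\beta^*\mid\alpha,\beta\in\mathscr L^*,\ A\in\mathscr B_\alpha\cap\mathscr B_\beta,\ |\alpha|-|\beta|=n\}$ for $n\in\mathbb Z$.
   Context: A graded ring is graded regular if for every homogeneous $x$ there is $y$ in the ring with $xyx=x$. Let $E=(E^0,E^1,r,s)$ be a directed graph; paths are sequences of edges $e_1e_2\cdots$ with $r(e_i)=s(e_{i+1})$. A labeling is a surjective map $\mathscr L\colon E^1\to\mathscr A$ onto a set (alphabet) $\mathscr A$; it extends to paths by $\mathscr L(e_1\cdots e_n)=\mathscr L(e_1)\cdots\mathscr L(e_n)$. $\mathscr L^{\geq1}$ is the set of words $\mathscr L(\mu)$ for finite paths $\mu$ of length at least $1$, and $\mathscr L^*=\{\varepsilon\}\cup\mathscr L^{\ge1}$ with $\varepsilon$ the empty word; $|\alpha|$ is the length of the word $\alpha$, $|\varepsilon|=0$. For $A\subseteq E^0$ and $\alpha\in\mathscr L^{*}$, the relative range is $r(A,\alpha)=\{r(\mu)\mid\mu\text{ a finite path},\mathscr L(\mu)=\alpha,\ s(\mu)\in A\}$ if $\alpha\in\mathscr L^{\geq 1}$, and $r(A,\varepsilon)=A$. Put $r(\alpha)=r(E^0,\alpha)$ and $\mathscr L(AE^1)=\{\mathscr L(e)\mid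 e\in E^1,\ s(e)\in A\}$. A labeled space is a triple $(E,\mathscr L,\mathscr B)$ with $\mathscr B$ a set of subsets of $E^0$ that is closed under finite intersections and finite unions, contains $r(\alpha)$ for every $\alpha\in\mathscr L^*$, and satisfies $r(A,\alpha)\in\mathscr B$ for all $A\in\mathscr B$, $\alpha\in\mathscr L^*$. It is weakly left-resolving if $r(A\cap B,\alpha)=r(A,\alpha)\cap r(B,\alpha)$ for all $A,B\in\mathscr B$, $\alpha\in\mathscr L^{\geq1}$, and normal if it is weakly left-resolving and $\mathscr B$ is closed under relative complements. For $\alpha\in\mathscr L^*$, $\mathscr B_\alpha=\{A\in\mathscr B\mid A\subseteq r(\alpha)\}$. A nonempty $A\in\mathscr B$ is regular if $0<|\mathscr L(BE^1)|<\infty$ for every $B\in\mathscr B$ with $\emptyset\ne B\subseteq A$; $\mathscr B_{reg}$ is the set of regular elements together with $\emptyset$. $L_K(\mathscr E)$ is the universal (associative) $K$-algebra generated by $\{p_A\mid A\in\mathscr B\}\cup\{s_a,s_a^*\mid a\in\mathscr A\}$ subject to: (i) $p_{A\cap B}=p_Ap_B$, $p_{A\cup B}=p_A+p_B-p_{A\cap B}$, $p_\emptyset=0$ for $A,B\in\mathscr B$; (ii) $p_As_a=s_ap_{r(A,a)}$ and $s_a^*p_A=p_{r(A,a)}s_a^*$ for $A\in\mathscr B$, $a\in\mathscr A$; (iii) $s_a^*s_a=p_{r(a)}$ and $s_b^*s_a=0$ if $b\ne a$, for $a,b\in\mathscr A$; (iv) $s_as_a^*s_a=s_a$ and $s_a^*s_as_a^*=s_a^*$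 for $a\in\mathscr A$; (v) $p_A=\sum_{a\in\mathscr L(AE^1)}s_ap_{r(A,a)}s_a^*$ for every $A\in\mathscr B_{reg}$. For $\alpha=a_1\cdots a_n\in\mathscr L^{\geq1}$, $s_\alpha=s_{a_1}\cdots s_{a_n}$ and $s_\alpha^*=s_{a_n}^*\cdots s_{a_1}^*$; $s_\varepsilon$ and $s_\varepsilon^*$ are to be omitted (act as identity) in expressions $s_\alpha p_As_\beta^*$. *)

theory Defs
  imports
    "Graph_Theory.Arc_Walk"
    "HOL-Library.Poly_Mapping"
    "HOL-Algebra.Module"
    "HOL-Algebra.QuotRing"
begin

section \<open>Labeled spaces\<close>

text \<open>Source and range of an edge are \<^const>\<open>tail\<close> and \<^const>\<open>head\<close>. The sets of vertices, edges and
  letters are explicit carriers, so that each of them may be empty.\<close>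

record ('v, 'e, 'a) labeled_space =
  digraph_of :: "('v, 'e) pre_digraph"
  labeling :: "'e \<Rightarrow> 'a"
  alphabet :: "'a set"
  family :: "'v set set"

definition labeled_words1 :: "('v, 'e, 'a) labeled_space \<Rightarrow> 'a list set" where
  "labeled_words1 \<E> =
    {map (labeling \<E>) \<mu> | \<mu>. \<mu> \<noteq> [] \<and> (\<exists>u v. pre_digraph.awalk (digraph_of \<E>) u \<mu> v)}"

definition labeled_words :: "('v, 'e, 'a) labeled_space \<Rightarrow> 'a list set" where
  "labeled_words \<E> = {[]} \<union> labeled_words1 \<E>"

definition rel_range :: "('v, 'e, 'a) labeled_space \<Rightarrow> 'v set \<Rightarrow> 'a list \<Rightarrow> 'v set" where
  "rel_range \<E> A \<alpha> =
    (if \<alpha> = [] then A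
     else {v. \<exists>u\<in>A. \<exists>\<mu>. pre_digraph.awalk (digraph_of \<E>) u \<mu> v \<and> map (labeling \<E>) \<mu> = \<alpha>})"

definition word_range :: "('v, 'e, 'a) labeled_space \<Rightarrow> 'a list \<Rightarrow> 'v set" where
  "word_range \<E> \<alpha> = rel_range \<E> (verts (digraph_of \<E>)) \<alpha>"

definition out_labels :: "('v, 'e, 'a) labeled_space \<Rightarrow> 'v set \<Rightarrow> 'a set" where
  "out_labels \<E> A =
    {labeling \<E> e | e. e \<in> arcs (digraph_of \<E>) \<and> tail (digraph_of \<E>) e \<in> A}"

locale labeled_space =
  fixes \<E> :: "('v, 'e, 'a) labeled_space"
  assumes wf_graph: "wf_digraph (digraph_of \<E>)"
    and labeling_surj: "labeling \<E> ` arcs (digraph_of \<E>) = alphabet \<E>"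
    and family_subset: "A \<in> family \<E> \<Longrightarrow> A \<subseteq> verts (digraph_of \<E>)"
    and family_Int: "A \<in> family \<E> \<Longrightarrow> B \<in> family \<E> \<Longrightarrow> A \<inter> B \<in> family \<E>"
    and family_Un: "A \<in> family \<E> \<Longrightarrow> B \<in> family \<E> \<Longrightarrow> A \<union> B \<in> family \<E>"
    and family_word_range: "\<alpha> \<in> labeled_words \<E> \<Longrightarrow> word_range \<E> \<alpha> \<in> family \<E>"
    and family_rel_range:
      "A \<in> family \<E> \<Longrightarrow> \<alpha> \<in> labeled_words \<E> \<Longrightarrow> rel_range \<E> A \<alpha> \<in> family \<E>"

locale weakly_left_resolving_labeled_space = labeled_space +
  assumes weakly_left_resolving:
    "A \<in> family \<E> \<Longrightarrow> B \<in> family \<E> \<Longrightarrow> \<alpha> \<in> labeled_words1 \<E> \<Longrightarrow>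
      rel_range \<E> (A \<inter> B) \<alpha> = rel_range \<E> A \<alpha> \<inter> rel_range \<E> B \<alpha>"

locale normal_labeled_space = weakly_left_resolving_labeled_space +
  assumes family_Diff: "A \<in> family \<E> \<Longrightarrow> B \<in> family \<E> \<Longrightarrow> A - B \<in> family \<E>"

definition family_below :: "('v, 'e, 'a) labeled_space \<Rightarrow> 'a list \<Rightarrow> 'v set set" where
  "family_below \<E> \<alpha> = {A \<in> family \<E>. A \<subseteq> word_range \<E> \<alpha>}"

definition regular_sets :: "('v, 'e, 'a) labeled_space \<Rightarrow> 'v set set" where
  "regular_sets \<E> =
    {A \<in> family \<E>. A \<noteq> {} \<and>
      (\<forall>B\<in>family \<E>. B \<noteq> {} \<and> B \<subseteq> A \<longrightarrow> finite (out_labels \<E> B) \<and> 0 < card (out_labels \<E> B))}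
    \<union> {{}}"


section \<open>Algebras given by generators and relations\<close>

text \<open>Words over \<^typ>\<open>'g\<close> form the free monoid, written additively as \<^theory>\<open>HOL-Library.Poly_Mapping\<close>
  expects for exponents. Hence \<open>'g word \<Rightarrow>\<^sub>0 'k\<close> is the algebra of noncommutative polynomials.\<close>

datatype 'g word = Word (letters: "'g list")

instantiation word :: (type) monoid_add
begin

definition zero_word :: "'a word" where
  "0 = Word []"

definition plus_word :: "'a word \<Rightarrow> 'a word \<Rightarrow> 'a word" where
  "v + w = Word (letters v @ letters w)"

instance
  by standard (simp_all add: zero_word_def plus_word_def)

end

definition field_ring :: "'k::field ring" where
  "field_ring = \<lparr>carrier = UNIV, mult = (*), one = 1, zero = 0, add = (+)\<rparr>"

text \<open>The free associative algebra without unit on \<open>X\<close>: no empty words. The record field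
  \<^const>\<open>one\<close> is therefore meaningless here. A scalar \<open>c\<close> acts as multiplication by the
  constant polynomial \<open>c\<close>.\<close>

definition free_algebra :: "'g set \<Rightarrow> ('k::field, 'g word \<Rightarrow>\<^sub>0 'k) module" where
  "free_algebra X =
    \<lparr>carrier = {f. \<forall>w\<in>Poly_Mapping.keys f. letters w \<noteq> [] \<and> set (letters w) \<subseteq> X},
     mult = (*), one = undefined, zero = 0, add = (+),
     smult = (\<lambda>c f. Poly_Mapping.single 0 c * f)\<rparr>"

definition gen :: "'g \<Rightarrow> 'g word \<Rightarrow>\<^sub>0 'k::field" where
  "gen x = Poly_Mapping.single (Word [x]) 1"

definition lin_span :: "('k::field, 'b) module \<Rightarrow> 'b set \<Rightarrow> 'b set" where
  "lin_span M S = \<Inter> {U. submodule U field_ring M \<and> S \<subseteq> U}"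

text \<open>\<^const>\<open>ideal\<close> and \<^const>\<open>genideal\<close> are only for rings with unit, where closure under scalars
  is automatic.\<close>

definition algebra_ideal :: "('k::field, 'b) module \<Rightarrow> 'b set \<Rightarrow> bool" where
  "algebra_ideal M J \<longleftrightarrow>
    submodule J field_ring M \<and>
    (\<forall>x\<in>carrier M. \<forall>y\<in>J. x \<otimes>\<^bsub>M\<^esub> y \<in> J \<and> y \<otimes>\<^bsub>M\<^esub> x \<in> J)"

definition gen_algebra_ideal :: "('k::field, 'b) module \<Rightarrow> 'b set \<Rightarrow> 'b set" where
  "gen_algebra_ideal M S = \<Inter> {J. algebra_ideal M J \<and> S \<subseteq> J}"


section \<open>The Leavitt labeled path algebra\<close>

datatype ('v, 'a) lpa_gen = Proj "'v set" | Edge 'a | Ghost 'a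

definition lpa_gens :: "('v, 'e, 'a) labeled_space \<Rightarrow> ('v, 'a) lpa_gen set" where
  "lpa_gens \<E> = Proj ` family \<E> \<union> Edge ` alphabet \<E> \<union> Ghost ` alphabet \<E>"

text \<open>A relation \<open>x = y\<close> is represented by \<open>x - y\<close>.\<close>

inductive_set lpa_relations ::
    "('v, 'e, 'a) labeled_space \<Rightarrow> (('v, 'a) lpa_gen word \<Rightarrow>\<^sub>0 'k::field) set"
  for \<E> :: "('v, 'e, 'a) labeled_space" where
  proj_Int: "A \<in> family \<E> \<Longrightarrow> B \<in> family \<E> \<Longrightarrow>
    gen (Proj (A \<inter> B)) - gen (Proj A) * gen (Proj B) \<in> lpa_relations \<E>"
| proj_Un: "A \<in> family \<E> \<Longrightarrow> B \<in> family \<E> \<Longrightarrow>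
    gen (Proj (A \<union> B)) - (gen (Proj A) + gen (Proj B) - gen (Proj (A \<inter> B))) \<in> lpa_relations \<E>"
| proj_empty: "gen (Proj {}) \<in> lpa_relations \<E>"
| proj_edge: "A \<in> family \<E> \<Longrightarrow> a \<in> alphabet \<E> \<Longrightarrow>
    gen (Proj A) * gen (Edge a) - gen (Edge a) * gen (Proj (rel_range \<E> A [a])) \<in> lpa_relations \<E>"
| ghost_proj: "A \<in> family \<E> \<Longrightarrow> a \<in> alphabet \<E> \<Longrightarrow>
    gen (Ghost a) * gen (Proj A) - gen (Proj (rel_range \<E> A [a])) * gen (Ghost a) \<in> lpa_relations \<E>"
| ghost_edge: "a \<in> alphabet \<E> \<Longrightarrow>
    gen (Ghost a) * gen (Edge a) - gen (Proj (word_range \<E> [a])) \<in> lpa_relations \<E>"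
| ghost_edge_neq: "a \<in> alphabet \<E> \<Longrightarrow> b \<in> alphabet \<E> \<Longrightarrow> b \<noteq> a \<Longrightarrow>
    gen (Ghost b) * gen (Edge a) \<in> lpa_relations \<E>"
| edge_ghost_edge: "a \<in> alphabet \<E> \<Longrightarrow>
    gen (Edge a) * gen (Ghost a) * gen (Edge a) - gen (Edge a) \<in> lpa_relations \<E>"
| ghost_edge_ghost: "a \<in> alphabet \<E> \<Longrightarrow>
    gen (Ghost a) * gen (Edge a) * gen (Ghost a) - gen (Ghost a) \<in> lpa_relations \<E>"
| proj_regular: "A \<in> regular_sets \<E> \<Longrightarrow>
    gen (Proj A) - (\<Sum>a\<in>out_labels \<E> A. gen (Edge a) * gen (Proj (rel_range \<E> A [a])) * gen (Ghost a))
      \<in> lpa_relations \<E>"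

definition lpa_ideal ::
    "('v, 'e, 'a) labeled_space \<Rightarrow> (('v, 'a) lpa_gen word \<Rightarrow>\<^sub>0 'k::field) set" where
  "lpa_ideal \<E> = gen_algebra_ideal (free_algebra (lpa_gens \<E>)) (lpa_relations \<E>)"

definition lpa_class ::
    "('v, 'e, 'a) labeled_space \<Rightarrow> (('v, 'a) lpa_gen word \<Rightarrow>\<^sub>0 'k::field) \<Rightarrow>
      (('v, 'a) lpa_gen word \<Rightarrow>\<^sub>0 'k) set" where
  "lpa_class \<E> f = a_r_coset (free_algebra (lpa_gens \<E>)) (lpa_ideal \<E>) f"

text \<open>The quotient of the free algebra by the relations, with the operations of \<^const>\<open>FactRing\<close>.
  The vertex set is the range of the empty word, hence a member of the family, and its
  projection is an identity for the generators. This is why it is entered as \<^const>\<open>one\<close>,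
  although no unit is imposed by the presentation.\<close>

definition LPA ::
    "('v, 'e, 'a) labeled_space \<Rightarrow> ('k::field, (('v, 'a) lpa_gen word \<Rightarrow>\<^sub>0 'k) set) module" where
  "LPA \<E> =
    (let F = free_algebra (lpa_gens \<E>); I = lpa_ideal \<E>
     in \<lparr>carrier = a_rcosets\<^bsub>F\<^esub> I,
         mult = rcoset_mult F I,
         one = lpa_class \<E> (gen (Proj (verts (digraph_of \<E>)))),
         zero = I,
         add = set_add F,
         smult = (\<lambda>c Y. \<Union>f\<in>Y. I +>\<^bsub>F\<^esub> (c \<odot>\<^bsub>F\<^esub> f))\<rparr>)"

text \<open>The element \<open>s\<^sub>\<alpha> p\<^sub>A s\<^sub>\<beta>\<^sup>*\<close>. The inner fold multiplies \<open>p\<^sub>A\<close> on the right by the ghost edges of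
  \<open>\<beta>\<close>, from the last letter to the first; empty words contribute no factor.\<close>

definition lpa_monomial ::
    "('v, 'e, 'a) labeled_space \<Rightarrow> 'a list \<Rightarrow> 'v set \<Rightarrow> 'a list \<Rightarrow>
      (('v, 'a) lpa_gen word \<Rightarrow>\<^sub>0 'k::field) set" where
  "lpa_monomial \<E> \<alpha> A \<beta> =
    foldr (\<lambda>a x. lpa_class \<E> (gen (Edge a)) \<otimes>\<^bsub>LPA \<E>\<^esub> x) \<alpha>
      (foldr (\<lambda>b x. x \<otimes>\<^bsub>LPA \<E>\<^esub> lpa_class \<E> (gen (Ghost b))) \<beta>
        (lpa_class \<E> (gen (Proj A))))"

definition LPA_component ::
    "('v, 'e, 'a) labeled_space \<Rightarrow> int \<Rightarrow> (('v, 'a) lpa_gen word \<Rightarrow>\<^sub>0 'k::field) set set" where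
  "LPA_component \<E> n =
    lin_span (LPA \<E>)
      {lpa_monomial \<E> \<alpha> A \<beta> | \<alpha> A \<beta>.
        \<alpha> \<in> labeled_words \<E> \<and> \<beta> \<in> labeled_words \<E> \<and>
        A \<in> family_below \<E> \<alpha> \<inter> family_below \<E> \<beta> \<and> int (length \<alpha>) - int (length \<beta>) = n}"


section \<open>Graded regular rings\<close>

locale graded_ring = ring R for R (structure) +
  fixes component :: "int \<Rightarrow> 'a set"
  assumes component_subgroup: "additive_subgroup (component n) R"
    and component_direct_sum:
      "x \<in> carrier R \<Longrightarrow>
        \<exists>!f. (\<forall>n. f n \<in> component n) \<and> finite {n. f n \<noteq> \<zero>} \<and> x = (\<Oplus>n\<in>{n. f n \<noteq> \<zero>}. f n)"
    and component_mult: "x \<in> component m \<Longrightarrow> y \<in> component n \<Longrightarrow> x \<otimes> y \<in> component (m + n)"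

locale graded_regular_ring = graded_ring +
  assumes homogeneous_regular:
    "x \<in> component n \<Longrightarrow> \<exists>y\<in>carrier R. x \<otimes> y \<otimes> x = x"

end

theory Submission
  imports Defs
begin

text \<open>The grading comes from the free algebra, where Edge, Ghost and Proj have degrees 1, -1 and 0:
  all relations are homogeneous, hence so is the ideal, and modulo the relations every word of degree
  \<open>n\<close> is zero or some \<open>s\<^sub>\<alpha> p\<^sub>A s\<^sub>\<beta>\<^sup>*\<close> with \<open>|\<alpha>| - |\<beta>| = n\<close>.

  For regularity, an element involves only finitely many letters \<open>a\<close> and words of bounded length. The span
  \<open>D\<close> of the projections is commutative and regular, because by normality a linear combination of
  projections becomes scalar after cutting with finitely many sets and their complements. If \<open>s\<^sub>a\<^sup>* x\<close>
  is regular for all \<open>a\<close> and \<open>x = \<Sum> s\<^sub>a s\<^sub>a\<^sup>* x\<close>, then \<open>x\<close> is regular as well: eliminate the entries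
  \<open>s\<^sub>a\<^sup>* x\<close> one after the other, using that \<open>x\<close> is regular if \<open>x - x y x\<close> is. The same holds for rows.
  Thus one can strip off letters on both sides; in degree 0 this leads to extensions of \<open>D\<close> by an ideal,
  to which the same trick applies.\<close>

section \<open>Regularity of column and row extensions\<close>

text \<open>A homogeneous component is in general not closed under multiplication: a quasi-inverse
  of an element of degree n should have degree -n. An induction on words therefore has to carry two
  modules along, one for x and one for its quasi-inverse, and must control in which set the witness
  lies, not merely that it exists. Columns and rows cannot be read as honest matrices. The element
  s_a^* s_a is only the idempotent p_{r(a)}, and the alphabet may be infinite, so that the sum of
  the s_a s_a^* over finitely many letters need not be the unit. Columns are thus described inside
  the algebra, by their entries s_a^* x and the condition that this sum fixes x from the left. In
  degree 0 the span of the projections may meet the ideal of the elements that begin and end with a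
  letter, for instance through the relation for regular sets. The sum of the two is not direct, and
  no projection onto either of them is available. This does no harm: lifting quasi-inverses from the
  quotient uses only some decomposition of x.\<close>

abbreviation mult_into :: "('r, 'm) ring_scheme \<Rightarrow> 'r set \<Rightarrow> 'r set \<Rightarrow> 'r set \<Rightarrow> bool" where
  "mult_into R A B C \<equiv> \<forall>a\<in>A. \<forall>b\<in>B. a \<otimes>\<^bsub>R\<^esub> b \<in> C"

lemma (in abelian_group) additive_subgroup_intro:
  assumes "H \<subseteq> carrier G" "\<zero> \<in> H" "\<And>x y. x \<in> H \<Longrightarrow> y \<in> H \<Longrightarrow> x \<oplus> y \<in> H" "\<And>x. x \<in> H \<Longrightarrow> \<ominus> x \<in> H"
  shows "additive_subgroup H G"
  by (rule additive_subgroup.intro, rule add.subgroupI)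
     (use assms in \<open>auto simp: a_inv_def[symmetric]\<close>)

lemma (in abelian_group) additive_subgroup_minus:
  assumes "additive_subgroup H G" "x \<in> H" "y \<in> H"
  shows "x \<ominus> y \<in> H"
  using assms by (simp add: a_minus_def additive_subgroup.a_closed additive_subgroup.a_inv_closed)

lemma (in abelian_group) additive_subgroup_finsum:
  assumes "additive_subgroup H G" "f \<in> A \<rightarrow> H"
  shows "(\<Oplus>i\<in>A. f i) \<in> H"
proof (cases "finite A")
  case True
  then show ?thesis using assms(2)
  proof (induction A rule: finite_induct)
    case empty
    then show ?case using assms(1) by (simp add: additive_subgroup.zero_closed)
  next
    case (insert a F)
    then have "f a \<in> H" "f \<in> F \<rightarrow> H" by auto
    moreover then have "f a \<in> carrier G" "f \<in> F \<rightarrow> carrier G"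
      using additive_subgroup.a_subset[OF assms(1)] by auto
    ultimately show ?case
      using insert assms(1) by (simp add: additive_subgroup.a_closed)
  qed
next
  case False
  then show ?thesis using assms(1) by (simp add: finsum_infinite additive_subgroup.zero_closed)
qed

text \<open>McCoy's lemma: with \<open>u = x - x y x\<close> the witness \<open>w\<close> satisfies \<open>1 - x w = (1 - u z) (1 - x y)\<close>.\<close>

lemma (in ring) regular_if_defect_regular:
  assumes [simp]: "x \<in> carrier R" "y \<in> carrier R" "z \<in> carrier R"
    and z: "(x \<ominus> x \<otimes> y \<otimes> x) \<otimes> z \<otimes> (x \<ominus> x \<otimes> y \<otimes> x) = x \<ominus> x \<otimes> y \<otimes> x"
  shows "x \<otimes> (y \<oplus> (z \<ominus> z \<otimes> x \<otimes> y) \<ominus> (y \<otimes> x \<otimes> (z \<ominus> z \<otimes> x \<otimes> y))) \<otimes> x = x"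
    (is "x \<otimes> ?w \<otimes> x = x")
proof -
  have "x \<otimes> ?w \<otimes> x = x \<otimes> y \<otimes> x \<oplus> (x \<ominus> x \<otimes> y \<otimes> x) \<otimes> z \<otimes> (x \<ominus> x \<otimes> y \<otimes> x)"
    by (simp add: a_minus_def l_distr r_distr l_minus r_minus minus_add a_ac m_assoc)
  also have "\<dots> = x \<otimes> y \<otimes> x \<oplus> (x \<ominus> x \<otimes> y \<otimes> x)"
    by (simp only: z)
  also have "\<dots> = x"
    by (simp add: a_minus_def a_ac r_neg1 r_neg)
  finally show ?thesis .
qed

text \<open>Rows over R become columns over the opposite ring once \<open>S\<close> and
  \<open>T\<close> trade places. Statements on rows follow from those on columns in this way and
  need no second proof.\<close>

definition opposite :: "('r, 'm) ring_scheme \<Rightarrow> ('r, 'm) ring_scheme" where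
  "opposite R = R\<lparr>mult := \<lambda>x y. y \<otimes>\<^bsub>R\<^esub> x\<rparr>"

lemma opposite_simps [simp]:
  "carrier (opposite R) = carrier R" "mult (opposite R) x y = mult R y x" "one (opposite R) = one R"
  "zero (opposite R) = zero R" "add (opposite R) = add R"
  by (simp_all add: opposite_def)

lemma finsum_opposite [simp]: "finsum (opposite R) = finsum R"
  by (simp add: finsum_def fun_eq_iff)

lemma additive_subgroup_opposite [simp]:
  "additive_subgroup H (opposite R) \<longleftrightarrow> additive_subgroup H R"
  by (simp add: additive_subgroup_def)

lemma (in ring) ring_opposite: "ring (opposite R)"
proof (rule ringI)
  show "abelian_group (opposite R)"
    by (rule abelian_groupI) (auto simp: a_ac intro: l_neg a_inv_closed)
  show "monoid (opposite R)"
    by (rule monoidI) (auto simp: m_assoc)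
qed (auto simp: l_distr r_distr)

text \<open>The pair \<open>(M, W)\<close> behaves like two opposite off-diagonal corners of a matrix ring with
  one diagonal corner \<open>Q\<close>.\<close>

definition regular_context ::
    "('r, 'm) ring_scheme \<Rightarrow> 'r set \<Rightarrow> 'r set \<Rightarrow> 'r set \<Rightarrow> 'r set \<Rightarrow> bool" where
  "regular_context R D M W Q \<longleftrightarrow>
    additive_subgroup M R \<and> additive_subgroup W R \<and> additive_subgroup Q R \<and>
    mult_into R W M Q \<and> mult_into R M Q M \<and> mult_into R Q W W \<and>
    mult_into R D M M \<and> mult_into R W D W \<and>
    (\<forall>x\<in>M. \<exists>y\<in>W. x \<otimes>\<^bsub>R\<^esub> y \<otimes>\<^bsub>R\<^esub> x = x)"

text \<open>Isolates what the induction on words uses of the algebra: \<open>X\<close> is a finite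
  set of letters, \<open>D\<close> stands for the span of the projections, \<open>S\<close> and
  \<open>T\<close> for edges and ghost edges. Scalars do not occur.\<close>

locale leavitt_family = ring R for R (structure) +
  fixes D :: "'a set" and X :: "'i set" and S T :: "'i \<Rightarrow> 'a"
  assumes finite_index: "finite X"
    and D_subgroup: "additive_subgroup D R"
    and D_mult: "mult_into R D D D"
    and D_regular: "d \<in> D \<Longrightarrow> \<exists>d'\<in>D. d \<otimes> d' \<otimes> d = d"
    and S_closed [simp]: "a \<in> X \<Longrightarrow> S a \<in> carrier R"
    and T_closed [simp]: "a \<in> X \<Longrightarrow> T a \<in> carrier R"
    and T_S_neq: "a \<in> X \<Longrightarrow> b \<in> X \<Longrightarrow> b \<noteq> a \<Longrightarrow> T b \<otimes> S a = \<zero>"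
    and T_S: "a \<in> X \<Longrightarrow> T a \<otimes> S a \<in> D"
    and S_T_S: "a \<in> X \<Longrightarrow> S a \<otimes> T a \<otimes> S a = S a"
    and T_S_T: "a \<in> X \<Longrightarrow> T a \<otimes> S a \<otimes> T a = T a"
    and D_S: "a \<in> X \<Longrightarrow> d \<in> D \<Longrightarrow> \<exists>d'\<in>D. d \<otimes> S a = S a \<otimes> d'"
    and T_D: "a \<in> X \<Longrightarrow> d \<in> D \<Longrightarrow> \<exists>d'\<in>D. T a \<otimes> d = d' \<otimes> T a"
begin

definition range_idem :: 'a where
  "range_idem = (\<Oplus>a\<in>X. S a \<otimes> T a)"

text \<open>By \<open>range_idem_mult\<close> the first condition says that x is the sum of the
  \<open>S a \<otimes> (T a \<otimes> x)\<close>. So x is a column with entries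
  \<open>T a \<otimes> x\<close>, kept as an element of \<open>R\<close> instead of a function on
  \<open>X\<close>.\<close>

definition columns :: "'a set \<Rightarrow> 'a set" where
  "columns M = {x \<in> carrier R. range_idem \<otimes> x = x \<and> (\<forall>a\<in>X. T a \<otimes> x \<in> M)}"

definition rows :: "'a set \<Rightarrow> 'a set" where
  "rows M = {x \<in> carrier R. x \<otimes> range_idem = x \<and> (\<forall>a\<in>X. x \<otimes> S a \<in> M)}"

lemma range_idem_closed [simp]: "range_idem \<in> carrier R"
  unfolding range_idem_def by (rule finsum_closed) auto

lemma range_idem_mult:
  assumes "x \<in> carrier R"
  shows "range_idem \<otimes> x = (\<Oplus>a\<in>X. S a \<otimes> (T a \<otimes> x))"
proof -
  have "range_idem \<otimes> x = (\<Oplus>a\<in>X. S a \<otimes> T a \<otimes> x)"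
    unfolding range_idem_def using finite_index assms by (intro finsum_ldistr) auto
  also have "\<dots> = (\<Oplus>a\<in>X. S a \<otimes> (T a \<otimes> x))"
    by (rule finsum_cong') (use assms in \<open>auto simp: m_assoc\<close>)
  finally show ?thesis .
qed

lemma mult_range_idem:
  assumes "x \<in> carrier R"
  shows "x \<otimes> range_idem = (\<Oplus>a\<in>X. (x \<otimes> S a) \<otimes> T a)"
proof -
  have "x \<otimes> range_idem = (\<Oplus>a\<in>X. x \<otimes> (S a \<otimes> T a))"
    unfolding range_idem_def using finite_index assms by (intro finsum_rdistr) auto
  also have "\<dots> = (\<Oplus>a\<in>X. (x \<otimes> S a) \<otimes> T a)"
    by (rule finsum_cong') (use assms in \<open>auto simp: m_assoc\<close>)
  finally show ?thesis .
qed

lemma D_closed: "d \<in> D \<Longrightarrow> d \<in> carrier R"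
  using additive_subgroup.a_subset[OF D_subgroup] by blast

lemma finsum_single:
  assumes "a \<in> X" "f \<in> X \<rightarrow> carrier R" "\<And>b. b \<in> X \<Longrightarrow> b \<noteq> a \<Longrightarrow> f b = \<zero>"
  shows "(\<Oplus>b\<in>X. f b) = f a"
proof -
  have "(\<Oplus>b\<in>X. f b) = (\<Oplus>b\<in>X. if a = b then f b else \<zero>)"
    by (rule finsum_cong') (use assms in auto)
  also have "\<dots> = f a"
    using assms(1,2) finite_index by (intro finsum_singleton) auto
  finally show ?thesis .
qed

lemma range_idem_S: "a \<in> X \<Longrightarrow> range_idem \<otimes> S a = S a"
  by (subst range_idem_mult, simp, subst finsum_single[where a = a])
     (auto simp: T_S_neq S_T_S m_assoc[symmetric])

text \<open>With e = \<open>S a \<otimes> T a\<close> both sides equal e d e. The elements d1 and d2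
  supplied by \<open>D_S\<close> and \<open>T_D\<close> need not agree, so they are never
  compared.\<close>

lemma D_commute_range_proj:
  assumes a: "a \<in> X" and d: "d \<in> D"
  shows "d \<otimes> (S a \<otimes> T a) = (S a \<otimes> T a) \<otimes> d"
proof -
  note [simp] = a D_closed
  obtain d1 where d1: "d1 \<in> D" "d \<otimes> S a = S a \<otimes> d1" using D_S a d by blast
  obtain d2 where d2: "d2 \<in> D" "T a \<otimes> d = d2 \<otimes> T a" using T_D a d by blast
  have "d \<otimes> (S a \<otimes> T a) = S a \<otimes> T a \<otimes> (S a \<otimes> d1) \<otimes> T a"
    using d d1 by (simp add: m_assoc[symmetric] S_T_S)
  also have "\<dots> = S a \<otimes> (T a \<otimes> d) \<otimes> S a \<otimes> T a"
    using d d1 by (simp add: m_assoc d1(2)[symmetric])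
  also have "\<dots> = S a \<otimes> (d2 \<otimes> T a)"
    using d d2 by (simp add: m_assoc) (simp add: m_assoc[symmetric] T_S_T)
  also have "\<dots> = (S a \<otimes> T a) \<otimes> d"
    using d d2 by (simp add: m_assoc)
  finally show ?thesis .
qed

lemma D_commute_range_idem:
  assumes d: "d \<in> D"
  shows "d \<otimes> range_idem = range_idem \<otimes> d"
proof -
  have [simp]: "d \<in> carrier R" using d by (rule D_closed)
  have "d \<otimes> range_idem = (\<Oplus>a\<in>X. d \<otimes> (S a \<otimes> T a))"
    unfolding range_idem_def using finite_index by (intro finsum_rdistr) auto
  also have "\<dots> = (\<Oplus>a\<in>X. (S a \<otimes> T a) \<otimes> d)"
    by (rule finsum_cong') (auto simp: D_commute_range_proj d)
  also have "\<dots> = range_idem \<otimes> d"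
    unfolding range_idem_def using finite_index by (intro finsum_ldistr[symmetric]) auto
  finally show ?thesis .
qed

text \<open>The axioms are symmetric: reversing products and exchanging \<open>S\<close> with
  \<open>T\<close> interchanges \<open>D_S\<close> with \<open>T_D\<close> and \<open>S_T_S\<close>
  with \<open>T_S_T\<close>, and keeps the shape of the others.\<close>

lemma leavitt_family_opposite: "leavitt_family (opposite R) D X T S"
proof -
  show ?thesis
    by (intro leavitt_family.intro leavitt_family_axioms.intro ring_opposite)
      (use D_mult in \<open>auto simp: finite_index D_subgroup T_S T_S_neq S_T_S T_S_T D_closed m_assoc[symmetric]
        dest: D_regular D_S T_D\<close>)
qed

lemma range_idem_opposite:
  "leavitt_family.range_idem (opposite R) X T S = range_idem"
  using leavitt_family.range_idem_def[OF leavitt_family_opposite] by (simp add: range_idem_def)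

lemma rows_opposite: "leavitt_family.rows (opposite R) X T S M = columns M"
  using leavitt_family.rows_def[OF leavitt_family_opposite] by (simp add: columns_def range_idem_opposite)

lemma columns_opposite: "leavitt_family.columns (opposite R) X T S M = rows M"
  using leavitt_family.columns_def[OF leavitt_family_opposite] by (simp add: rows_def range_idem_opposite)

lemma columns_subgroup:
  assumes "additive_subgroup M R"
  shows "additive_subgroup (columns M) R"
proof -
  interpret M: additive_subgroup M R by fact
  show ?thesis
    by (rule additive_subgroup_intro) (auto simp: columns_def r_distr r_minus)
qed

lemma columns_mult:
  assumes "mult_into R A B C" "B \<subseteq> carrier R"
  shows "mult_into R (columns A) B (columns C)"
proof (intro ballI)
  fix x b assume x: "x \<in> columns A" and b: "b \<in> B"
  then have [simp]: "x \<in> carrier R" "b \<in> carrier R" using assms(2) by (auto simp: columns_def)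
  show "x \<otimes> b \<in> columns C"
    using x b assms(1) by (auto simp: columns_def m_assoc[symmetric])
qed

text \<open>Multiplication by d acts entry by entry, at a through the element that
  \<open>T_D\<close> supplies. As d commutes with \<open>range_idem\<close>, the result is again a
  column.\<close>

lemma D_mult_columns:
  assumes "mult_into R D M M" "M \<subseteq> carrier R"
  shows "mult_into R D (columns M) (columns M)"
proof (intro ballI)
  fix d x assume d: "d \<in> D" and x: "x \<in> columns M"
  then have [simp]: "x \<in> carrier R" "d \<in> carrier R" by (auto simp: columns_def D_closed)
  have "T a \<otimes> (d \<otimes> x) \<in> M" if a: "a \<in> X" for a
  proof -
    obtain d' where d': "d' \<in> D" "T a \<otimes> d = d' \<otimes> T a" using T_D a d by blast
    then have "T a \<otimes> (d \<otimes> x) = d' \<otimes> (T a \<otimes> x)"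
      using a by (simp add: m_assoc[symmetric] D_closed)
    then show ?thesis using d' x a assms(1) by (auto simp: columns_def)
  qed
  moreover have "range_idem \<otimes> (d \<otimes> x) = d \<otimes> x"
    using x by (simp add: columns_def m_assoc[symmetric] D_commute_range_idem[OF d, symmetric])
      (simp add: columns_def m_assoc)
  ultimately show "d \<otimes> x \<in> columns M" by (simp add: columns_def)
qed

lemma rows_subgroup: "additive_subgroup M R \<Longrightarrow> additive_subgroup (rows M) R"
  using leavitt_family.columns_subgroup[OF leavitt_family_opposite] by (simp add: columns_opposite)

lemma mult_rows:
  assumes "mult_into R B A C" "B \<subseteq> carrier R"
  shows "mult_into R B (rows A) (rows C)"
  using leavitt_family.columns_mult[OF leavitt_family_opposite, of A B C] assms
  by (auto simp: columns_opposite)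

lemma rows_mult_D:
  assumes "mult_into R M D M" "M \<subseteq> carrier R"
  shows "mult_into R (rows M) D (rows M)"
  using leavitt_family.D_mult_columns[OF leavitt_family_opposite, of M] assms
  by (auto simp: columns_opposite)

text \<open>Inserting \<open>range_idem\<close> between the factors gives the usual product of a row
  and a column, the sum over a of products of entries.\<close>

lemma rows_mult_columns:
  assumes "mult_into R A B C" "additive_subgroup C R" "A \<subseteq> carrier R" "B \<subseteq> carrier R"
  shows "mult_into R (rows A) (columns B) C"
proof (intro ballI)
  fix x y assume x: "x \<in> rows A" and y: "y \<in> columns B"
  then have [simp]: "x \<in> carrier R" "y \<in> carrier R" by (auto simp: columns_def rows_def)
  have "x \<otimes> y = (x \<otimes> range_idem) \<otimes> y" using x by (simp add: rows_def)
  also have "\<dots> = (\<Oplus>a\<in>X. (x \<otimes> S a \<otimes> T a) \<otimes> y)"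
    by (simp add: mult_range_idem, rule finsum_ldistr) (auto simp: finite_index)
  also have "\<dots> = (\<Oplus>a\<in>X. (x \<otimes> S a) \<otimes> (T a \<otimes> y))"
    by (rule finsum_cong') (auto simp: m_assoc)
  also have "\<dots> \<in> C"
    using assms(1) x y by (intro additive_subgroup_finsum assms) (auto simp: rows_def columns_def)
  finally show "x \<otimes> y \<in> C" .
qed

text \<open>A column whose only possibly nonzero entry is at a. That entry is
  \<open>T a \<otimes> S a \<otimes> m\<close> rather than m, whence the premise that
  \<open>M\<close> is closed under \<open>D\<close>.\<close>

lemma S_mult_columns:
  assumes "mult_into R D M M" "additive_subgroup M R" "a \<in> X" "m \<in> M"
  shows "S a \<otimes> m \<in> columns M"
proof -
  interpret M: additive_subgroup M R by fact
  have [simp]: "m \<in> carrier R" using assms(4) by simp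
  have "T b \<otimes> (S a \<otimes> m) \<in> M" if "b \<in> X" for b
    using that assms by (cases "b = a") (auto simp: m_assoc[symmetric] T_S T_S_neq)
  then show ?thesis
    using assms(3) by (auto simp: columns_def m_assoc[symmetric] range_idem_S)
qed

lemma rows_mult_T:
  assumes "mult_into R M D M" "additive_subgroup M R" "a \<in> X" "m \<in> M"
  shows "m \<otimes> T a \<in> rows M"
  using leavitt_family.S_mult_columns[OF leavitt_family_opposite, of M a m] assms
  by (auto simp: columns_opposite)

text \<open>Elimination in a column of rows returns a witness that is a row of columns. This
  inclusion puts it back among the columns of rows.\<close>

lemma rows_columns_subset: "rows (columns M) \<subseteq> columns (rows M)"
proof
  fix x assume x: "x \<in> rows (columns M)"
  then have [simp]: "x \<in> carrier R" by (simp add: rows_def)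
  have "range_idem \<otimes> x = range_idem \<otimes> (\<Oplus>a\<in>X. x \<otimes> S a \<otimes> T a)"
    using x by (simp add: rows_def flip: mult_range_idem)
  also have "\<dots> = (\<Oplus>a\<in>X. range_idem \<otimes> (x \<otimes> S a \<otimes> T a))"
    by (rule finsum_rdistr) (auto simp: finite_index)
  also have "\<dots> = (\<Oplus>a\<in>X. x \<otimes> S a \<otimes> T a)"
  proof (rule finsum_cong')
    fix a assume "a \<in> X"
    moreover then have "range_idem \<otimes> (x \<otimes> S a) = x \<otimes> S a"
      using x by (auto simp: rows_def columns_def)
    ultimately show "range_idem \<otimes> (x \<otimes> S a \<otimes> T a) = x \<otimes> S a \<otimes> T a"
      by (simp add: m_assoc[symmetric])
  qed auto
  also have "\<dots> = x" using x by (simp add: rows_def flip: mult_range_idem)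
  finally have "range_idem \<otimes> x = x" .
  moreover have "T a \<otimes> x \<in> rows M" if "a \<in> X" for a
    using x that by (auto simp: rows_def columns_def m_assoc)
  ultimately show "x \<in> columns (rows M)" by (simp add: columns_def)
qed

text \<open>Gaussian elimination with McCoy's lemma: an inverse of the entry \<open>T a \<otimes> x\<close> clears this entry
  and keeps the vanishing ones, so one inducts on a set \<open>F\<close> containing the nonzero entries.\<close>

lemma columns_regular:
  assumes ctx: "regular_context R D M W Q"
    and x: "x \<in> columns M"
  shows "\<exists>y\<in>rows W. x \<otimes> y \<otimes> x = x"
proof -
  note [simp del] = a_minus_def
  have M: "additive_subgroup M R" and W: "additive_subgroup W R" and Q: "additive_subgroup Q R"
    and WM: "mult_into R W M Q" and MQ: "mult_into R M Q M" and QW: "mult_into R Q W W"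
    and DM: "mult_into R D M M" and WD: "mult_into R W D W"
    and reg: "\<And>x. x \<in> M \<Longrightarrow> \<exists>y\<in>W. x \<otimes> y \<otimes> x = x"
    using ctx by (auto simp: regular_context_def)
  note MC = additive_subgroup.a_subset[OF M] and WC = additive_subgroup.a_subset[OF W]
    and QC = additive_subgroup.a_subset[OF Q]
  have RC: "mult_into R (rows W) (columns M) Q" by (rule rows_mult_columns[OF WM Q WC MC])
  have CQ: "mult_into R (columns M) Q (columns M)" by (rule columns_mult[OF MQ QC])
  have QR: "mult_into R Q (rows W) (rows W)" by (rule mult_rows[OF QW QC])
  note CS = columns_subgroup[OF M] and RS = rows_subgroup[OF W]
  have "\<exists>y\<in>rows W. x \<otimes> y \<otimes> x = x"
    if "finite F" "F \<subseteq> X" "x \<in> columns M" "\<forall>b\<in>X - F. T b \<otimes> x = \<zero>" for F x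
    using that
  proof (induction F arbitrary: x rule: finite_induct)
    case empty
    then have x: "x \<in> carrier R" "range_idem \<otimes> x = x" by (auto simp: columns_def)
    have "range_idem \<otimes> x = (\<Oplus>a\<in>X. \<zero>)"
      unfolding range_idem_mult[OF x(1)] by (rule finsum_cong') (use empty in auto)
    then have "x = \<zero>" using x by (simp add: finsum_zero)
    then show ?case
      using additive_subgroup.zero_closed[OF RS] by (auto intro!: bexI[of _ "\<zero>"])
  next
    case (insert a F)
    have a [simp]: "a \<in> X" using insert by auto
    have x: "x \<in> columns M" and Tx: "T a \<otimes> x \<in> M" using insert.prems by (auto simp: columns_def)
    have [simp]: "x \<in> carrier R" using x by (auto simp: columns_def)
    obtain w where w: "w \<in> W" "T a \<otimes> x \<otimes> w \<otimes> (T a \<otimes> x) = T a \<otimes> x"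
      using reg[OF Tx] by blast
    have [simp]: "w \<in> carrier R" using w WC by auto
    define y where "y = w \<otimes> T a"
    have y: "y \<in> rows W" unfolding y_def by (rule rows_mult_T[OF WD W a w(1)])
    have [simp]: "y \<in> carrier R" by (simp add: y_def)
    have yx: "y \<otimes> x \<in> Q" using RC y x by blast
    define u where "u = x \<ominus> x \<otimes> y \<otimes> x"
    have u: "u \<in> columns M"
      unfolding u_def using CQ x yx by (intro additive_subgroup_minus[OF CS]) (auto simp: m_assoc)
    have Tu: "T b \<otimes> u = T b \<otimes> x \<ominus> T b \<otimes> x \<otimes> w \<otimes> (T a \<otimes> x)" if "b \<in> X" for b
      using that by (simp add: u_def y_def a_minus_def r_distr r_minus m_assoc)
    have "T b \<otimes> u = \<zero>" if "b \<in> X - F" for b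
    proof (cases "b = a")
      case True
      then show ?thesis using Tu[of a] by (simp add: w a_minus_def r_neg)
    next
      case False
      then have "T b \<otimes> x = \<zero>" using that insert.prems by auto
      then show ?thesis using Tu[of b] that by (simp add: a_minus_def)
    qed
    then obtain z where z: "z \<in> rows W" "u \<otimes> z \<otimes> u = u"
      using insert.IH[OF _ u] insert.prems by auto
    have [simp]: "z \<in> carrier R" using z by (simp add: rows_def)
    \<comment> \<open>The witness of \<open>regular_if_defect_regular\<close> is bracketed so that
      each product in it is an element of \<open>Q\<close> times an element of
      \<open>rows W\<close>, which keeps it in \<open>rows W\<close>.\<close>
    define v where "v = z \<ominus> z \<otimes> x \<otimes> y"
    have zx: "z \<otimes> x \<in> Q" using RC z x by blast
    have v: "v \<in> rows W"
      unfolding v_def using QR zx y z by (intro additive_subgroup_minus[OF RS]) auto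
    have "y \<oplus> v \<ominus> (y \<otimes> x \<otimes> v) \<in> rows W"
      using QR yx v y by (intro additive_subgroup_minus[OF RS] additive_subgroup.a_closed[OF RS]) auto
    moreover have "x \<otimes> (y \<oplus> v \<ominus> (y \<otimes> x \<otimes> v)) \<otimes> x = x"
      unfolding v_def by (rule regular_if_defect_regular) (use z in \<open>simp_all add: u_def\<close>)
    ultimately show ?case by blast
  qed
  from this[OF finite_index subset_refl x] show ?thesis by simp
qed

text \<open>\<open>Q\<close> and \<open>D\<close> stay fixed while \<open>M\<close> and
  \<open>W\<close> each gain one letter, so the step can be iterated. This disposes of the surplus
  letters of a monomial of nonzero degree.\<close>

lemma regular_context_columns:
  assumes ctx: "regular_context R D M W Q"
  shows "regular_context R D (columns M) (rows W) Q"
proof -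
  have M: "additive_subgroup M R" and W: "additive_subgroup W R" and Q: "additive_subgroup Q R"
    and WM: "mult_into R W M Q" and MQ: "mult_into R M Q M" and QW: "mult_into R Q W W"
    and DM: "mult_into R D M M" and WD: "mult_into R W D W"
    using ctx by (auto simp: regular_context_def)
  note MC = additive_subgroup.a_subset[OF M] and WC = additive_subgroup.a_subset[OF W]
    and QC = additive_subgroup.a_subset[OF Q]
  show ?thesis
    unfolding regular_context_def
    by (intro conjI columns_subgroup rows_subgroup M W Q rows_mult_columns[OF WM Q WC MC]
        columns_mult[OF MQ QC] mult_rows[OF QW QC] D_mult_columns[OF DM MC] rows_mult_D[OF WD WC]
        ballI columns_regular[OF ctx])
qed

lemma regular_context_opposite_rows:
  "regular_context (opposite R) D M W Q \<Longrightarrow> regular_context (opposite R) D (rows M) (columns W) Q"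
  using leavitt_family.regular_context_columns[OF leavitt_family_opposite, of M W Q]
  by (simp add: columns_opposite rows_opposite)

text \<open>\<open>level N\<close> is the span of the elements \<open>S\<^sub>\<alpha> d T\<^sub>\<beta>\<close> with \<open>|\<alpha>| = |\<beta>| \<le> N\<close>, and the summand
  \<open>columns (rows (level N))\<close> is an ideal of \<open>level (Suc N)\<close> with quotient an image of \<open>D\<close>.\<close>

primrec level :: "nat \<Rightarrow> 'a set" where
  "level 0 = D"
| "level (Suc N) = {d \<oplus> c | d c. d \<in> D \<and> c \<in> columns (rows (level N))}"

text \<open>In the step, U is the previous level and C = \<open>columns (rows U)\<close> is an ideal
  of the next one. C is regular by elimination along rows and then along columns. An element d + c
  is first treated with a quasi-inverse of d, which leaves a defect in C.\<close>

lemma level_regular_subring: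
  "additive_subgroup (level N) R \<and> mult_into R (level N) (level N) (level N) \<and> D \<subseteq> level N \<and>
    (\<forall>x\<in>level N. \<exists>y\<in>level N. x \<otimes> y \<otimes> x = x)"
proof (induction N)
  case 0
  show ?case using D_subgroup D_mult D_regular by auto
next
  case (Suc N)
  define U where "U = level N"
  define C where "C = columns (rows U)"
  have U: "additive_subgroup U R" and UU: "mult_into R U U U" and DU: "D \<subseteq> U"
    and reg: "\<And>x. x \<in> U \<Longrightarrow> \<exists>y\<in>U. x \<otimes> y \<otimes> x = x"
    using Suc.IH by (auto simp: U_def)
  note UC = additive_subgroup.a_subset[OF U]
  have rU: "additive_subgroup (rows U) R" and C: "additive_subgroup C R"
    unfolding C_def by (intro columns_subgroup rows_subgroup U)+
  note rUC = additive_subgroup.a_subset[OF rU] and CC = additive_subgroup.a_subset[OF C]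
  have UrU: "mult_into R U (rows U) (rows U)" by (rule mult_rows[OF UU UC])
  have DrU: "mult_into R D (rows U) (rows U)" using UrU DU by blast
  have rUD: "mult_into R (rows U) D (rows U)"
    by (rule rows_mult_D[OF _ UC]) (use UU DU in blast)
  have rUrC: "mult_into R (rows U) C (rows U)"
    unfolding C_def by (rule rows_mult_columns[OF UrU rU UC rUC])
  have CxC: "mult_into R C C C"
    using columns_mult[OF rUrC CC] by (simp add: C_def)
  have DC: "mult_into R D C C"
    unfolding C_def by (rule D_mult_columns[OF DrU rUC])
  have CD: "mult_into R C D C"
    unfolding C_def by (rule columns_mult[OF rUD]) (use D_closed in blast)
  have V: "level (Suc N) = {d \<oplus> c | d c. d \<in> D \<and> c \<in> C}" by (simp add: U_def C_def)
  note [simp del] = level.simps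
  have VI: "d \<oplus> c \<in> level (Suc N)" if "d \<in> D" "c \<in> C" for d c using that V by blast
  have D_V: "d \<in> level (Suc N)" if "d \<in> D" for d
    using VI[OF that additive_subgroup.zero_closed[OF C]] that by (simp add: D_closed)
  have C_V: "c \<in> level (Suc N)" if "c \<in> C" for c
    using VI[OF additive_subgroup.zero_closed[OF D_subgroup] that] that CC
    by auto
  have V_sub: "additive_subgroup (level (Suc N)) R"
  proof (rule additive_subgroup_intro)
    show "level (Suc N) \<subseteq> carrier R" using V D_closed CC by auto
    show "\<zero> \<in> level (Suc N)" by (rule D_V) (rule additive_subgroup.zero_closed[OF D_subgroup])
  next
    fix x y assume "x \<in> level (Suc N)" "y \<in> level (Suc N)"
    then obtain d c d' c' where *: "d \<in> D" "c \<in> C" "d' \<in> D" "c' \<in> C" "x = d \<oplus> c" "y = d' \<oplus> c'"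
      using V by blast
    then have "x \<oplus> y = (d \<oplus> d') \<oplus> (c \<oplus> c')"
      using CC by (simp add: a_ac D_closed subset_eq)
    then show "x \<oplus> y \<in> level (Suc N)"
      using VI * by (simp add: additive_subgroup.a_closed[OF D_subgroup] additive_subgroup.a_closed[OF C])
  next
    fix x assume "x \<in> level (Suc N)"
    then obtain d c where *: "d \<in> D" "c \<in> C" "x = d \<oplus> c" using V by blast
    then have "\<ominus> x = (\<ominus> d) \<oplus> (\<ominus> c)"
      using CC by (simp add: minus_add D_closed subset_eq)
    then show "\<ominus> x \<in> level (Suc N)"
      using VI * by (simp add: additive_subgroup.a_inv_closed[OF D_subgroup] additive_subgroup.a_inv_closed[OF C])
  qed
  note V_add = additive_subgroup.a_closed[OF V_sub]
  have CV: "mult_into R C (level (Suc N)) C"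
    unfolding V using CxC CD CC
    by (auto simp: r_distr D_closed subset_eq intro!: additive_subgroup.a_closed[OF C])
  have VV: "mult_into R (level (Suc N)) (level (Suc N)) (level (Suc N))"
  proof (intro ballI)
    fix x y assume x: "x \<in> level (Suc N)" and y: "y \<in> level (Suc N)"
    obtain d c where dc: "d \<in> D" "c \<in> C" "x = d \<oplus> c" using x V by blast
    obtain d' c' where dc': "d' \<in> D" "c' \<in> C" "y = d' \<oplus> c'" using y V by blast
    have "x \<otimes> y = d \<otimes> d' \<oplus> (d \<otimes> c' \<oplus> c \<otimes> y)"
      using dc dc' CC by (simp add: r_distr l_distr a_ac D_closed subset_eq)
    moreover have "d \<otimes> d' \<in> D" "d \<otimes> c' \<in> C" "c \<otimes> y \<in> C"
      using dc dc' y D_mult DC CV by blast+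
    ultimately show "x \<otimes> y \<in> level (Suc N)"
      by (simp add: VI additive_subgroup.a_closed[OF C])
  qed
  \<comment> \<open>\<open>U\<close> is a context over itself. One elimination yields quasi-inverses
    in \<open>columns U\<close> for the elements of \<open>rows U\<close>.\<close>
  have "regular_context (opposite R) D U U U"
    unfolding regular_context_def using U UU DU reg
    by (simp add: subset_eq) (metis m_assoc UC subset_eq)
  then have row: "regular_context (opposite R) D (rows U) (columns U) U"
    by (rule regular_context_opposite_rows)
  have cU: "additive_subgroup (columns U) R" by (rule columns_subgroup[OF U])
  note cUC = additive_subgroup.a_subset[OF cU]
  have cUrU: "mult_into R (columns U) (rows U) C"
    unfolding C_def by (rule columns_mult[OF UrU rUC])
  have CcU: "mult_into R C (columns U) (columns U)"
    unfolding C_def by (rule columns_mult[OF _ cUC]) (rule rows_mult_columns[OF UU U UC UC])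
  have cUD: "mult_into R (columns U) D (columns U)"
    by (rule columns_mult) (use UU DU D_closed in auto)
  \<comment> \<open>The corner is now C: a column times a row is a square array, whereas in the
    previous context a row times a column gave an element of \<open>U\<close>.\<close>
  have "regular_context R D (rows U) (columns U) C"
    unfolding regular_context_def
    using rU cU C cUrU rUrC CcU DrU cUD row cUC rUC
    by (simp add: regular_context_def subset_eq m_assoc)
  then have C_reg: "\<exists>y\<in>C. x \<otimes> y \<otimes> x = x" if "x \<in> C" for x
    using columns_regular[of "rows U" "columns U" C x] that rows_columns_subset[of U] by (auto simp: C_def)
  have "\<exists>y\<in>level (Suc N). x \<otimes> y \<otimes> x = x" if x: "x \<in> level (Suc N)" for x
  proof -
    obtain d c where dc: "d \<in> D" "c \<in> C" "x = d \<oplus> c" using x V by blast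
    obtain y where y: "y \<in> D" "d \<otimes> y \<otimes> d = d" using D_regular dc by blast
    have [simp]: "d \<in> carrier R" "c \<in> carrier R" "y \<in> carrier R" "x \<in> carrier R"
      using dc y CC by (auto simp: D_closed)
    define u where "u = x \<ominus> x \<otimes> y \<otimes> x"
    \<comment> \<open>Every term except \<open>d \<otimes> y \<otimes> d\<close>, which is d, has a
      factor c. So d cancels in the defect u, and u lies in the ideal C.\<close>
    have "x \<otimes> y \<otimes> x = d \<otimes> y \<otimes> d \<oplus> (d \<otimes> (y \<otimes> c) \<oplus> c \<otimes> (y \<otimes> x))"
      by (simp add: dc l_distr r_distr m_assoc a_ac)
    then have "u = c \<ominus> (d \<otimes> (y \<otimes> c) \<oplus> c \<otimes> (y \<otimes> x))"
      by (simp add: u_def y dc(3)[symmetric])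
        (simp add: dc(3) a_minus_def minus_add a_ac r_neg1 r_neg r_neg2)
    also have "\<dots> \<in> C"
      using dc y x DC CV VV D_V
      by (intro additive_subgroup_minus[OF C] additive_subgroup.a_closed[OF C]) auto
    finally obtain z where z: "z \<in> C" "u \<otimes> z \<otimes> u = u" using C_reg by blast
    have [simp]: "z \<in> carrier R" using z CC by auto
    define v where "v = z \<ominus> z \<otimes> x \<otimes> y"
    have v: "v \<in> level (Suc N)"
      unfolding v_def using VV x y z D_V C_V by (intro additive_subgroup_minus[OF V_sub]) auto
    have "y \<oplus> v \<ominus> (y \<otimes> x \<otimes> v) \<in> level (Suc N)"
      using VV x y v D_V by (intro additive_subgroup_minus[OF V_sub] V_add) auto
    moreover have "x \<otimes> (y \<oplus> v \<ominus> (y \<otimes> x \<otimes> v)) \<otimes> x = x"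
      unfolding v_def by (rule regular_if_defect_regular) (use z in \<open>simp_all add: u_def\<close>)
    ultimately show ?thesis by blast
  qed
  then show ?case using V_sub VV D_V by blast
qed

lemma regular_context_level:
  "regular_context R D (level N) (level N) (level N)"
  using level_regular_subring[of N] by (auto simp: regular_context_def)

lemma regular_context_columns_level:
  "regular_context R D ((columns ^^ n) (level N)) ((rows ^^ n) (level N)) (level N)"
  by (induction n) (simp_all add: regular_context_level regular_context_columns)

lemma regular_context_rows_level:
  "regular_context (opposite R) D ((rows ^^ n) (level N)) ((columns ^^ n) (level N)) (level N)"
proof (induction n)
  case 0
  show ?case
    using level_regular_subring[of N]
    by (simp add: regular_context_def subset_eq)
      (metis m_assoc additive_subgroup.a_Hcarr)
qed (simp add: regular_context_opposite_rows)

lemma columns_level_regular: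
  "x \<in> (columns ^^ n) (level N) \<Longrightarrow> \<exists>y\<in>carrier R. x \<otimes> y \<otimes> x = x"
  using regular_context_columns_level[of n N] unfolding regular_context_def
  by (metis additive_subgroup.a_Hcarr)

lemma rows_level_regular:
  "x \<in> (rows ^^ n) (level N) \<Longrightarrow> \<exists>y\<in>carrier R. x \<otimes> y \<otimes> x = x"
  using regular_context_rows_level[of n N] unfolding regular_context_def
  by simp (metis additive_subgroup.a_Hcarr m_assoc)

section \<open>Monomials as members of iterated columns and rows\<close>

definition sandwich :: "'i list \<Rightarrow> 'a \<Rightarrow> 'i list \<Rightarrow> 'a" where
  "sandwich \<alpha> d \<beta> = foldr (\<lambda>a x. S a \<otimes> x) \<alpha> (foldr (\<lambda>b x. x \<otimes> T b) \<beta> d)"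

lemma sandwich_closed [simp]:
  assumes "set \<alpha> \<subseteq> X" "set \<beta> \<subseteq> X" "d \<in> carrier R"
  shows "sandwich \<alpha> d \<beta> \<in> carrier R"
proof -
  have "foldr (\<lambda>b x. x \<otimes> T b) \<beta> d \<in> carrier R"
    using assms(2,3) by (induction \<beta>) auto
  then show ?thesis
    using assms(1) unfolding sandwich_def by (induction \<alpha>) auto
qed

lemma sandwich_Cons_left: "sandwich (a # \<alpha>) d \<beta> = S a \<otimes> sandwich \<alpha> d \<beta>"
  by (simp add: sandwich_def)

lemma sandwich_Cons_right:
  assumes "set \<alpha> \<subseteq> X" "set \<beta> \<subseteq> X" "b \<in> X" "d \<in> carrier R"
  shows "sandwich \<alpha> d (b # \<beta>) = sandwich \<alpha> d \<beta> \<otimes> T b"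
  using assms(1)
proof (induction \<alpha>)
  case Nil
  then show ?case by (simp add: sandwich_def)
next
  case (Cons a \<alpha>)
  then show ?case using assms by (simp add: sandwich_Cons_left m_assoc)
qed

text \<open>The outermost letters on the two sides account for one layer of columns and rows. Words
  shorter than N are covered because every level contains \<open>D\<close>.\<close>

lemma sandwich_in_level:
  assumes "set \<alpha> \<subseteq> X" "set \<beta> \<subseteq> X" "d \<in> D" "length \<alpha> = length \<beta>" "length \<alpha> \<le> N"
  shows "sandwich \<alpha> d \<beta> \<in> level N"
  using assms
proof (induction \<alpha> arbitrary: \<beta> N)
  case Nil
  then show ?case using level_regular_subring[of N] by (auto simp: sandwich_def)
next
  case (Cons a \<alpha>)
  then obtain b \<gamma> M where [simp]: "\<beta> = b # \<gamma>" "N = Suc M" by (cases \<beta>; cases N) auto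
  have m: "sandwich \<alpha> d \<gamma> \<in> level M" using Cons by simp
  have U: "additive_subgroup (level M) R" "mult_into R (level M) (level M) (level M)" "D \<subseteq> level M"
    using level_regular_subring[of M] by auto
  have "sandwich \<alpha> d \<gamma> \<otimes> T b \<in> rows (level M)"
    using Cons.prems m U by (intro rows_mult_T) auto
  moreover have "mult_into R D (rows (level M)) (rows (level M))"
    using mult_rows[OF U(2) additive_subgroup.a_subset[OF U(1)]] U(3) by blast
  ultimately have c: "S a \<otimes> (sandwich \<alpha> d \<gamma> \<otimes> T b) \<in> columns (rows (level M))"
    using Cons.prems U by (intro S_mult_columns rows_subgroup) auto
  have "sandwich (a # \<alpha>) d \<beta> = \<zero> \<oplus> S a \<otimes> (sandwich \<alpha> d \<gamma> \<otimes> T b)"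
    using Cons.prems by (simp add: sandwich_Cons_left sandwich_Cons_right D_closed)
  then show ?case
    using c additive_subgroup.zero_closed[OF D_subgroup] by auto
qed

lemma sandwich_in_columns:
  assumes "set \<alpha> \<subseteq> X" "set \<beta> \<subseteq> X" "d \<in> D" "length \<alpha> = n + length \<beta>" "length \<beta> \<le> N"
  shows "sandwich \<alpha> d \<beta> \<in> (columns ^^ n) (level N)"
  using assms
proof (induction n arbitrary: \<alpha>)
  case 0
  then show ?case by (simp add: sandwich_in_level)
next
  case (Suc n)
  then obtain a \<gamma> where [simp]: "\<alpha> = a # \<gamma>" by (cases \<alpha>) auto
  show ?case
    using Suc regular_context_columns_level[of n N]
    by (simp add: sandwich_Cons_left S_mult_columns regular_context_def)
qed

lemma sandwich_in_rows:
  assumes "set \<alpha> \<subseteq> X" "set \<beta> \<subseteq> X" "d \<in> D" "length \<beta> = n + length \<alpha>" "length \<alpha> \<le> N"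
  shows "sandwich \<alpha> d \<beta> \<in> (rows ^^ n) (level N)"
  using assms
proof (induction n arbitrary: \<beta>)
  case 0
  then show ?case by (simp add: sandwich_in_level)
next
  case (Suc n)
  then obtain b \<gamma> where [simp]: "\<beta> = b # \<gamma>" by (cases \<beta>) auto
  show ?case
    using Suc regular_context_rows_level[of n N]
    by (simp add: sandwich_Cons_right rows_mult_T regular_context_def D_closed)
qed

end

section \<open>Spans and labeled spaces\<close>

lemma field_ring_simps [simp]:
  "carrier (field_ring :: 'k::field ring) = UNIV" "\<one>\<^bsub>(field_ring :: 'k ring)\<^esub> = 1"
  "\<zero>\<^bsub>(field_ring :: 'k ring)\<^esub> = 0" "x \<otimes>\<^bsub>field_ring\<^esub> y = x * (y :: 'k)"
  "x \<oplus>\<^bsub>field_ring\<^esub> y = x + (y :: 'k)"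
  by (simp_all add: field_ring_def)

lemma cring_field_ring: "cring (field_ring :: 'k::field ring)"
proof (rule cringI)
  show "abelian_group (field_ring :: 'k ring)"
  proof (rule abelian_groupI)
    fix x :: 'k
    show "\<exists>y\<in>carrier field_ring. y \<oplus>\<^bsub>field_ring\<^esub> x = \<zero>\<^bsub>field_ring\<^esub>"
      by (rule bexI[of _ "- x"]) simp_all
  qed (simp_all add: algebra_simps)
  show "comm_monoid (field_ring :: 'k ring)"
    by (rule comm_monoidI) (simp_all add: algebra_simps)
qed (simp add: algebra_simps)

lemma lin_span_least: "submodule V field_ring M \<Longrightarrow> A \<subseteq> V \<Longrightarrow> lin_span M A \<subseteq> V"
  by (auto simp: lin_span_def)

lemma lin_span_base: "A \<subseteq> lin_span M A"
  by (auto simp: lin_span_def)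

lemma submodule_additive_subgroup: "submodule V S M \<Longrightarrow> additive_subgroup V M"
  by (simp add: submodule_def additive_subgroup_def)

text \<open>If \<open>A\<close> leaves the carrier, then no submodule contains it and the
  intersection defining the span is the whole type. For \<open>A\<close> inside, the carrier is one
  of the submodules that are intersected.\<close>

lemma submodule_lin_span:
  assumes M: "module field_ring M" and A: "A \<subseteq> carrier M"
  shows "submodule (lin_span M A) field_ring M"
proof -
  interpret M: module field_ring M by fact
  have "submodule (carrier M) field_ring M"
    by (rule M.submoduleI) auto
  then have "lin_span M A \<subseteq> carrier M" using A by (rule lin_span_least)
  then show ?thesis
    by (rule M.submoduleI)
      (auto simp: lin_span_def M.submoduleE(3) intro: additive_subgroup.zero_closed[OF submodule_additive_subgroup]
        dest: M.submoduleE(4)[simplified] M.submoduleE(5))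
qed

section \<open>Relative ranges of words\<close>

context labeled_space
begin

lemma letter_labeled_word:
  assumes "a \<in> alphabet \<E>"
  shows "[a] \<in> labeled_words \<E>"
proof -
  interpret wf_digraph "digraph_of \<E>" by (rule wf_graph)
  obtain e where e: "e \<in> arcs (digraph_of \<E>)" "labeling \<E> e = a"
    using assms labeling_surj by (metis imageE)
  then have "awalk (tail (digraph_of \<E>) e) [e] (head (digraph_of \<E>) e)"
    by (simp add: awalk_def)
  then have "map (labeling \<E>) [e] \<in> labeled_words1 \<E>"
    unfolding labeled_words1_def by blast
  then show ?thesis using e by (simp add: labeled_words_def)
qed

lemma rel_range_Nil [simp]: "rel_range \<E> A [] = A"
  by (simp add: rel_range_def)

lemma rel_range_Cons: "rel_range \<E> A (a # \<alpha>) = rel_range \<E> (rel_range \<E> A [a]) \<alpha>"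
proof (cases "\<alpha> = []")
  case False
  interpret wf_digraph "digraph_of \<E>" by (rule wf_graph)
  have edge: "w \<in> rel_range \<E> A [a] \<longleftrightarrow> (\<exists>e\<in>arcs (digraph_of \<E>).
      tail (digraph_of \<E>) e \<in> A \<and> head (digraph_of \<E>) e = w \<and> labeling \<E> e = a)" for w
    by (auto simp: rel_range_def awalk_Cons_iff map_eq_Cons_conv awalk_Nil_iff)
      (metis arc_implies_awalk)
  have "rel_range \<E> A (a # \<alpha>) = {v. \<exists>u\<in>A. \<exists>e \<mu>. awalk u (e # \<mu>) v \<and> labeling \<E> e = a \<and>
      map (labeling \<E>) \<mu> = \<alpha>}"
    by (auto simp: rel_range_def Cons_eq_map_conv map_eq_Cons_conv)
  also have "\<dots> = {v. \<exists>e\<in>arcs (digraph_of \<E>). tail (digraph_of \<E>) e \<in> A \<and>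
      labeling \<E> e = a \<and> (\<exists>\<mu>. awalk (head (digraph_of \<E>) e) \<mu> v \<and> map (labeling \<E>) \<mu> = \<alpha>)}"
    unfolding awalk_Cons_iff by blast
  also have "\<dots> = {v. \<exists>w\<in>rel_range \<E> A [a]. \<exists>\<mu>. awalk w \<mu> v \<and> map (labeling \<E>) \<mu> = \<alpha>}"
    unfolding Bex_def edge by blast
  also have "\<dots> = rel_range \<E> (rel_range \<E> A [a]) \<alpha>"
    using False by (simp add: rel_range_def)
  finally show ?thesis .
qed simp

text \<open>Every single letter labels an edge, so one letter at a time reaches all words over the
  alphabet, including those that label no path. Monomials can thus be formed for arbitrary
  words.\<close>

lemma rel_range_family:
  "A \<in> family \<E> \<Longrightarrow> set \<alpha> \<subseteq> alphabet \<E> \<Longrightarrow> rel_range \<E> A \<alpha> \<in> family \<E>"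
proof (induction \<alpha> arbitrary: A)
  case (Cons a \<alpha>)
  then have "rel_range \<E> A [a] \<in> family \<E>"
    by (intro family_rel_range letter_labeled_word) auto
  then show ?case using Cons by (simp add: rel_range_Cons[of _ a \<alpha>])
qed simp

lemma verts_family: "verts (digraph_of \<E>) \<in> family \<E>"
  using family_word_range[of "[]"] by (simp add: labeled_words_def word_range_def)

lemma word_range_not_labeled:
  assumes "\<alpha> \<notin> labeled_words \<E>"
  shows "word_range \<E> \<alpha> = {}"
  using assms by (auto simp: labeled_words_def labeled_words1_def word_range_def rel_range_def)

lemma word_range_family: "set \<alpha> \<subseteq> alphabet \<E> \<Longrightarrow> word_range \<E> \<alpha> \<in> family \<E>"
  by (simp add: word_range_def rel_range_family verts_family)

lemma out_labels_alphabet: "out_labels \<E> A \<subseteq> alphabet \<E>"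
  using labeling_surj by (auto simp: out_labels_def)

end

lemma (in normal_labeled_space) empty_family: "{} \<in> family \<E>"
  using family_Diff[OF verts_family verts_family] by simp

section \<open>Regularity of spans of monomials\<close>

text \<open>States the relations as equations in a ring with unit. Polynomials and cosets then
  matter for the regularity argument only when the locale is instantiated with the quotient.\<close>

locale labeled_representation =
  normal_labeled_space \<E> + ring R
  for \<E> :: "('v, 'e, 'a) labeled_space" and R :: "('k::field, 'r) module" (structure) +
  fixes P :: "'v set \<Rightarrow> 'r" and S T :: "'a \<Rightarrow> 'r"
  assumes module: "module field_ring R"
    and smult_mult: "x \<in> carrier R \<Longrightarrow> y \<in> carrier R \<Longrightarrow> (c \<odot> x) \<otimes> y = c \<odot> (x \<otimes> y)"
    and mult_smult: "x \<in> carrier R \<Longrightarrow> y \<in> carrier R \<Longrightarrow> x \<otimes> (c \<odot> y) = c \<odot> (x \<otimes> y)"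
    and P_closed [simp]: "A \<in> family \<E> \<Longrightarrow> P A \<in> carrier R"
    and S_closed [simp]: "a \<in> alphabet \<E> \<Longrightarrow> S a \<in> carrier R"
    and T_closed [simp]: "a \<in> alphabet \<E> \<Longrightarrow> T a \<in> carrier R"
    and P_Int: "A \<in> family \<E> \<Longrightarrow> B \<in> family \<E> \<Longrightarrow> P (A \<inter> B) = P A \<otimes> P B"
    and P_Un: "A \<in> family \<E> \<Longrightarrow> B \<in> family \<E> \<Longrightarrow> P (A \<union> B) = P A \<oplus> P B \<ominus> P (A \<inter> B)"
    and P_empty: "P {} = \<zero>"
    and P_S: "A \<in> family \<E> \<Longrightarrow> a \<in> alphabet \<E> \<Longrightarrow> P A \<otimes> S a = S a \<otimes> P (rel_range \<E> A [a])"
    and T_P: "A \<in> family \<E> \<Longrightarrow> a \<in> alphabet \<E> \<Longrightarrow> T a \<otimes> P A = P (rel_range \<E> A [a]) \<otimes> T a"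
    and T_S_same: "a \<in> alphabet \<E> \<Longrightarrow> T a \<otimes> S a = P (word_range \<E> [a])"
    and T_S_diff: "a \<in> alphabet \<E> \<Longrightarrow> b \<in> alphabet \<E> \<Longrightarrow> b \<noteq> a \<Longrightarrow> T b \<otimes> S a = \<zero>"
    and S_T_S: "a \<in> alphabet \<E> \<Longrightarrow> S a \<otimes> T a \<otimes> S a = S a"
    and T_S_T: "a \<in> alphabet \<E> \<Longrightarrow> T a \<otimes> S a \<otimes> T a = T a"
    and P_verts: "P (verts (digraph_of \<E>)) = \<one>"
begin

interpretation M: module field_ring R by (rule module)

lemmas submoduleI = M.submoduleI[simplified]

lemma smult_closed [simp]: "x \<in> carrier R \<Longrightarrow> c \<odot> x \<in> carrier R"
  by (rule M.smult_closed) simp_all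

section \<open>The commutative algebra spanned by the projections\<close>

definition diagonal :: "'r set" where
  "diagonal = lin_span R (P ` family \<E>)"

lemma submodule_diagonal: "submodule diagonal field_ring R"
  unfolding diagonal_def by (rule submodule_lin_span[OF module]) auto

lemma diagonal_induct:
  assumes "submodule V field_ring R" "\<And>A. A \<in> family \<E> \<Longrightarrow> P A \<in> V" "x \<in> diagonal"
  shows "x \<in> V"
  using lin_span_least[OF assms(1), of "P ` family \<E>"] assms(2,3) by (auto simp: diagonal_def)

lemma P_diagonal: "A \<in> family \<E> \<Longrightarrow> P A \<in> diagonal"
  using lin_span_base[of "P ` family \<E>" R] by (auto simp: diagonal_def)

sublocale diagonal: additive_subgroup diagonal R
  by (rule submodule_additive_subgroup[OF submodule_diagonal])

lemma diagonal_smult: "x \<in> diagonal \<Longrightarrow> c \<odot> x \<in> diagonal"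
  using M.submoduleE(4)[OF submodule_diagonal] by simp

lemma smult_simps [simp]:
  assumes "x \<in> carrier R"
  shows "0 \<odot> x = \<zero>" "1 \<odot> x = x" "c \<odot> \<zero> = \<zero>" "c \<odot> (b \<odot> x) = (c * b) \<odot> x"
    "c \<odot> (\<ominus> x) = \<ominus> (c \<odot> x)"
  using assms M.smult_l_null[of x] M.smult_one[of x] M.smult_r_null[of c] M.smult_assoc1[of c b x]
    M.smult_r_minus[of c x] by simp_all

lemma smult_add: "x \<in> carrier R \<Longrightarrow> y \<in> carrier R \<Longrightarrow> c \<odot> (x \<oplus> y) = c \<odot> x \<oplus> c \<odot> y"
  using M.smult_r_distr[of c x y] by simp

lemma add_smult: "x \<in> carrier R \<Longrightarrow> (b + c) \<odot> x = b \<odot> x \<oplus> c \<odot> x"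
  using M.smult_l_distr[of b c x] by simp

lemma diagonal_mult: "mult_into R diagonal diagonal diagonal"
proof (intro ballI)
  fix x y assume x: "x \<in> diagonal" and y: "y \<in> diagonal"
  have 1: "x \<otimes> P B \<in> diagonal" if B: "B \<in> family \<E>" and x: "x \<in> diagonal" for x B
  proof -
    let ?V = "{x \<in> carrier R. x \<otimes> P B \<in> diagonal}"
    have "submodule ?V field_ring R"
      by (rule submoduleI) (auto simp: B l_distr l_minus smult_mult diagonal_smult)
    then have "x \<in> ?V"
      by (rule diagonal_induct[OF _ _ x]) (simp add: B P_Int[symmetric] P_diagonal family_Int)
    then show ?thesis by simp
  qed
  let ?V = "{y \<in> carrier R. x \<otimes> y \<in> diagonal}"
  have "submodule ?V field_ring R"
    by (rule submoduleI) (auto simp: x r_distr r_minus mult_smult diagonal_smult)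
  then have "y \<in> ?V"
    by (rule diagonal_induct[OF _ _ y]) (simp add: 1 x)
  then show "x \<otimes> y \<in> diagonal" by simp
qed

lemma P_commute: "A \<in> family \<E> \<Longrightarrow> B \<in> family \<E> \<Longrightarrow> P A \<otimes> P B = P B \<otimes> P A"
  by (simp add: P_Int[symmetric] inf_commute)

lemma diagonal_commute:
  assumes x: "x \<in> diagonal" and y: "y \<in> diagonal"
  shows "x \<otimes> y = y \<otimes> x"
proof -
  have 1: "x \<otimes> P B = P B \<otimes> x" if "B \<in> family \<E>" "x \<in> diagonal" for x B
  proof -
    let ?V = "{x \<in> carrier R. x \<otimes> P B = P B \<otimes> x}"
    have "submodule ?V field_ring R"
      by (rule submoduleI) (auto simp: that l_distr l_minus r_distr r_minus smult_mult mult_smult)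
    then have "x \<in> ?V"
      by (rule diagonal_induct[OF _ _ that(2)]) (simp add: that P_commute)
    then show ?thesis by simp
  qed
  let ?V = "{y \<in> carrier R. x \<otimes> y = y \<otimes> x}"
  have "submodule ?V field_ring R"
    by (rule submoduleI) (auto simp: x l_distr l_minus r_distr r_minus smult_mult mult_smult)
  then have "y \<in> ?V"
    by (rule diagonal_induct[OF _ _ y]) (simp add: x 1)
  then show ?thesis by simp
qed

text \<open>The place where closure under relative complements splits a projection into two
  orthogonal ones.\<close>

lemma P_Diff:
  assumes "A \<in> family \<E>" "B \<in> family \<E>"
  shows "P B = P (B \<inter> A) \<oplus> P (B - A)"
proof -
  have "P ((B \<inter> A) \<union> (B - A)) = P (B \<inter> A) \<oplus> P (B - A) \<ominus> P ((B \<inter> A) \<inter> (B - A))"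
    using assms by (intro P_Un family_Int family_Diff)
  moreover have "(B \<inter> A) \<union> (B - A) = B" "(B \<inter> A) \<inter> (B - A) = {}" by auto
  ultimately show ?thesis
    using assms by (simp add: P_empty a_minus_def family_Int family_Diff)
qed

text \<open>Cutting with a set and its complement turns a linear combination of projections into scalar
  multiples of projections, whence the quantification over \<open>B\<close> and \<open>c\<close>.\<close>

definition locally_regular :: "'r \<Rightarrow> bool" where
  "locally_regular x \<longleftrightarrow> x \<in> diagonal \<and> (\<forall>B\<in>family \<E>. \<forall>c. \<exists>y\<in>diagonal.
    (c \<odot> P B \<oplus> x \<otimes> P B) \<otimes> y \<otimes> (c \<odot> P B \<oplus> x \<otimes> P B) = c \<odot> P B \<oplus> x \<otimes> P B)"

text \<open>Each quasi-inverse is cut with the idempotent supporting its own summand. Since p1 and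
  p2 are orthogonal, all cross terms vanish.\<close>

lemma regular_add_orthogonal:
  assumes "x1 \<in> diagonal" "x2 \<in> diagonal" "y1 \<in> diagonal" "y2 \<in> diagonal" "p1 \<in> diagonal" "p2 \<in> diagonal"
    and "x1 \<otimes> y1 \<otimes> x1 = x1" "x2 \<otimes> y2 \<otimes> x2 = x2"
    and "x1 \<otimes> p1 = x1" "x2 \<otimes> p2 = x2" "p1 \<otimes> p2 = \<zero>"
  shows "(x1 \<oplus> x2) \<otimes> (y1 \<otimes> p1 \<oplus> y2 \<otimes> p2) \<otimes> (x1 \<oplus> x2) = x1 \<oplus> x2"
proof -
  note [simp] = assms(1-6) diagonal.a_Hcarr
  have 1: "p1 \<otimes> x1 = x1" "p2 \<otimes> x2 = x2" using assms(9,10) diagonal_commute[of p1 x1] diagonal_commute[of p2 x2]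
    by simp_all
  have "p1 \<otimes> x2 = p1 \<otimes> (p2 \<otimes> x2)" "p2 \<otimes> x1 = p2 \<otimes> (p1 \<otimes> x1)" by (simp_all add: 1)
  moreover have "p2 \<otimes> p1 = \<zero>" using assms(11) diagonal_commute[of p1 p2] by simp
  ultimately have 2: "p1 \<otimes> x2 = \<zero>" "p2 \<otimes> x1 = \<zero>"
    using assms(11) by (simp_all add: m_assoc[symmetric])
  have "x1 \<otimes> (y2 \<otimes> (p2 \<otimes> x2)) = x1 \<otimes> p1 \<otimes> (p2 \<otimes> x2) \<otimes> y2"
    using assms(9) by (simp add: 1 m_assoc diagonal_commute[of y2 x2])
  also have "\<dots> = \<zero>" using assms(11) by (simp add: m_assoc 1 2)
  finally have 3: "x1 \<otimes> (y2 \<otimes> x2) = \<zero>" by (simp add: 1)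
  have "x2 \<otimes> (y1 \<otimes> (p1 \<otimes> x1)) = x2 \<otimes> p2 \<otimes> (p1 \<otimes> x1) \<otimes> y1"
    using assms(10) by (simp add: 1 m_assoc diagonal_commute[of y1 x1])
  also have "\<dots> = \<zero>" by (simp add: m_assoc 1 2)
  finally have 4: "x2 \<otimes> (y1 \<otimes> x1) = \<zero>" by (simp add: 1)
  have "(x1 \<oplus> x2) \<otimes> (y1 \<otimes> p1 \<oplus> y2 \<otimes> p2) \<otimes> (x1 \<oplus> x2)
    = (x1 \<oplus> x2) \<otimes> (y1 \<otimes> x1 \<oplus> y2 \<otimes> x2)"
    by (simp add: m_assoc l_distr r_distr 1 2 diagonal_mult)
  also have "\<dots> = x1 \<oplus> x2"
    using assms(7,8) by (simp add: l_distr r_distr 3 4 m_assoc)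
  finally show ?thesis .
qed

text \<open>On \<open>B \<inter> A\<close> the new summand acts as the scalar b and is absorbed into
  c; on \<open>B - A\<close> it vanishes. Both parts are covered by the hypothesis on x, and they
  are orthogonal.\<close>

lemma locally_regular_add:
  assumes x: "locally_regular x" and A: "A \<in> family \<E>"
  shows "locally_regular (x \<oplus> b \<odot> P A)"
  unfolding locally_regular_def
proof (intro conjI ballI allI)
  have x': "x \<in> diagonal" using x by (simp add: locally_regular_def)
  show "x \<oplus> b \<odot> P A \<in> diagonal"
    using x' A by (simp add: P_diagonal diagonal_smult)
  fix B c assume B: "B \<in> family \<E>"
  let ?B1 = "B \<inter> A" and ?B2 = "B - A"
  have fam: "?B1 \<in> family \<E>" "?B2 \<in> family \<E>" using A B by (auto intro: family_Int family_Diff)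
  have [simp]: "x \<in> carrier R" "P A \<in> carrier R" "P B \<in> carrier R" "P ?B1 \<in> carrier R" "P ?B2 \<in> carrier R"
    using x' A B fam by (auto simp: diagonal.a_Hcarr)
  define x1 where "x1 = (c + b) \<odot> P ?B1 \<oplus> x \<otimes> P ?B1"
  define x2 where "x2 = c \<odot> P ?B2 \<oplus> x \<otimes> P ?B2"
  have AB: "P A \<otimes> P ?B1 = P ?B1" "P A \<otimes> P ?B2 = \<zero>"
    using A B fam P_empty by (simp_all add: P_Int[symmetric] Int_absorb1 Diff_disjoint)
  have split: "c \<odot> P B \<oplus> (x \<oplus> b \<odot> P A) \<otimes> P B = x1 \<oplus> x2"
    unfolding x1_def x2_def P_Diff[OF A B]
    by (simp add: smult_add add_smult l_distr r_distr smult_mult mult_smult AB a_ac)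
  obtain y1 where y1: "y1 \<in> diagonal" "x1 \<otimes> y1 \<otimes> x1 = x1"
    using x fam(1) unfolding locally_regular_def x1_def by blast
  obtain y2 where y2: "y2 \<in> diagonal" "x2 \<otimes> y2 \<otimes> x2 = x2"
    using x fam(2) unfolding locally_regular_def x2_def by blast
  have idem: "P ?B1 \<otimes> P ?B1 = P ?B1" "P ?B2 \<otimes> P ?B2 = P ?B2" "P ?B1 \<otimes> P ?B2 = \<zero>"
  proof -
    have "?B1 \<inter> ?B2 = {}" by auto
    then show "P ?B1 \<otimes> P ?B1 = P ?B1" "P ?B2 \<otimes> P ?B2 = P ?B2" "P ?B1 \<otimes> P ?B2 = \<zero>"
      using fam P_empty by (simp_all add: P_Int[symmetric])
  qed
  have "x1 \<in> diagonal" "x2 \<in> diagonal"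
    unfolding x1_def x2_def using x' fam diagonal_mult by (auto simp: P_diagonal diagonal_smult)
  then have "(x1 \<oplus> x2) \<otimes> (y1 \<otimes> P ?B1 \<oplus> y2 \<otimes> P ?B2) \<otimes> (x1 \<oplus> x2) = x1 \<oplus> x2"
    by (rule regular_add_orthogonal)
      (use fam y1 y2 idem in \<open>auto simp: P_diagonal x1_def x2_def l_distr smult_mult m_assoc\<close>)
  moreover have "y1 \<otimes> P ?B1 \<oplus> y2 \<otimes> P ?B2 \<in> diagonal"
    using y1 y2 fam diagonal_mult by (auto simp: P_diagonal)
  ultimately show "\<exists>y\<in>diagonal. (c \<odot> P B \<oplus> (x \<oplus> b \<odot> P A) \<otimes> P B) \<otimes> y \<otimes>
      (c \<odot> P B \<oplus> (x \<oplus> b \<odot> P A) \<otimes> P B) = c \<odot> P B \<oplus> (x \<oplus> b \<odot> P A) \<otimes> P B"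
    unfolding split by blast
qed

lemma locally_regular_zero: "locally_regular \<zero>"
  unfolding locally_regular_def
proof (intro conjI ballI allI)
  fix B and c :: 'k assume B: "B \<in> family \<E>"
  have "P B \<otimes> P B = P B" using B by (simp add: P_Int[symmetric])
  \<comment> \<open>For c = 0 both sides are zero, whatever the value of
    \<open>inverse 0\<close>.\<close>
  then have "(c \<odot> P B) \<otimes> (inverse c \<odot> P B) \<otimes> (c \<odot> P B) = c \<odot> P B"
    using B by (cases "c = 0") (simp_all add: smult_mult mult_smult)
  then show "\<exists>y\<in>diagonal. (c \<odot> P B \<oplus> \<zero> \<otimes> P B) \<otimes> y \<otimes> (c \<odot> P B \<oplus> \<zero> \<otimes> P B) = c \<odot> P B \<oplus> \<zero> \<otimes> P B"
    using B by (intro bexI[of _ "inverse c \<odot> P B"]) (simp_all add: diagonal_smult P_diagonal)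
qed simp

lemma diagonal_regular:
  assumes x: "x \<in> diagonal"
  shows "\<exists>y\<in>diagonal. x \<otimes> y \<otimes> x = x"
proof -
  \<comment> \<open>That sums of locally regular elements are locally regular is not known
    beforehand. The property of preserving local regularity under translation by all multiples of x,
    however, is visibly closed under sums and holds for projections.\<close>
  let ?V = "{x \<in> carrier R. \<forall>c z. locally_regular z \<longrightarrow> locally_regular (z \<oplus> c \<odot> x)}"
  have [simp]: "locally_regular z \<Longrightarrow> z \<in> carrier R" for z
    by (simp add: locally_regular_def diagonal.a_Hcarr)
  have "submodule ?V field_ring R"
  proof (rule submoduleI)
    fix x assume x: "x \<in> ?V"
    have "locally_regular (z \<oplus> c \<odot> (\<ominus> x))" if "locally_regular z" for z c
    proof -
      have "c \<odot> (\<ominus> x) = (- c) \<odot> x"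
        using x add_smult[of x c "- c"] by (simp add: minus_equality a_comm)
      then show ?thesis using x that by simp
    qed
    then show "\<ominus> x \<in> ?V" using x by simp
  qed (auto simp: smult_add a_assoc[symmetric])
  then have "x \<in> ?V"
    by (rule diagonal_induct[OF _ _ x]) (simp add: locally_regular_add)
  then have "locally_regular (\<zero> \<oplus> 1 \<odot> x)" using locally_regular_zero by blast
  then have "locally_regular x" using x by simp
  \<comment> \<open>The instance c = 0 with \<open>B\<close> the vertex set returns x itself,
    because that projection is the unit.\<close>
  then show ?thesis
    using x verts_family P_verts unfolding locally_regular_def
    by (metis l_zero r_one one_closed smult_simps(1) diagonal.a_Hcarr)
qed

text \<open>For \<open>P A\<close> one takes \<open>P (rel_range \<E> A [a])\<close>. Mere existence
  is asserted because the projections are linearly dependent, so a linear map on their span would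
  first have to be shown well defined.\<close>

lemma diagonal_S:
  assumes a: "a \<in> alphabet \<E>" and d: "d \<in> diagonal"
  shows "\<exists>d'\<in>diagonal. d \<otimes> S a = S a \<otimes> d'"
proof -
  let ?V = "{d \<in> carrier R. \<exists>d'\<in>diagonal. d \<otimes> S a = S a \<otimes> d'}"
  have "submodule ?V field_ring R"
  proof (rule submoduleI)
    fix x y assume "x \<in> ?V" "y \<in> ?V"
    then obtain x' y' where *: "x \<in> carrier R" "y \<in> carrier R" "x' \<in> diagonal" "y' \<in> diagonal"
        "x \<otimes> S a = S a \<otimes> x'" "y \<otimes> S a = S a \<otimes> y'"
      by blast
    then have "(x \<oplus> y) \<otimes> S a = S a \<otimes> (x' \<oplus> y')" using a by (simp add: l_distr r_distr)
    then show "x \<oplus> y \<in> ?V" using * by auto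
  next
    fix x assume "x \<in> ?V"
    then obtain x' where *: "x \<in> carrier R" "x' \<in> diagonal" "x \<otimes> S a = S a \<otimes> x'" by blast
    then have "(\<ominus> x) \<otimes> S a = S a \<otimes> (\<ominus> x')" using a by (simp add: l_minus r_minus)
    then show "\<ominus> x \<in> ?V" using * by auto
    fix c
    have "(c \<odot> x) \<otimes> S a = S a \<otimes> (c \<odot> x')" using a * by (simp add: smult_mult mult_smult)
    then show "c \<odot> x \<in> ?V" using * by (auto intro: diagonal_smult)
  qed (use a in \<open>auto intro!: bexI[of _ "\<zero>"]\<close>)
  moreover have "P A \<in> ?V" if "A \<in> family \<E>" for A
    using that a rel_range_family[of A "[a]"] by (auto simp: P_S P_diagonal)
  ultimately show ?thesis using diagonal_induct[OF _ _ d] by blast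
qed

lemma T_diagonal:
  assumes a: "a \<in> alphabet \<E>" and d: "d \<in> diagonal"
  shows "\<exists>d'\<in>diagonal. T a \<otimes> d = d' \<otimes> T a"
proof -
  let ?V = "{d \<in> carrier R. \<exists>d'\<in>diagonal. T a \<otimes> d = d' \<otimes> T a}"
  have "submodule ?V field_ring R"
  proof (rule submoduleI)
    fix x y assume "x \<in> ?V" "y \<in> ?V"
    then obtain x' y' where *: "x \<in> carrier R" "y \<in> carrier R" "x' \<in> diagonal" "y' \<in> diagonal"
        "T a \<otimes> x = x' \<otimes> T a" "T a \<otimes> y = y' \<otimes> T a"
      by blast
    then have "T a \<otimes> (x \<oplus> y) = (x' \<oplus> y') \<otimes> T a" using a by (simp add: l_distr r_distr)
    then show "x \<oplus> y \<in> ?V" using * by auto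
  next
    fix x assume "x \<in> ?V"
    then obtain x' where *: "x \<in> carrier R" "x' \<in> diagonal" "T a \<otimes> x = x' \<otimes> T a" by blast
    then have "T a \<otimes> (\<ominus> x) = (\<ominus> x') \<otimes> T a" using a by (simp add: l_minus r_minus)
    then show "\<ominus> x \<in> ?V" using * by auto
    fix c
    have "T a \<otimes> (c \<odot> x) = (c \<odot> x') \<otimes> T a" using a * by (simp add: smult_mult mult_smult)
    then show "c \<odot> x \<in> ?V" using * by (auto intro: diagonal_smult)
  qed (use a in \<open>auto intro!: bexI[of _ "\<zero>"]\<close>)
  moreover have "P A \<in> ?V" if "A \<in> family \<E>" for A
    using that a rel_range_family[of A "[a]"] by (auto simp: T_P P_diagonal)
  ultimately show ?thesis using diagonal_induct[OF _ _ d] by blast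
qed

lemma T_S_P_diagonal: "a \<in> alphabet \<E> \<Longrightarrow> T a \<otimes> S a \<in> diagonal"
  by (simp add: T_S_same P_diagonal word_range_family)

lemma leavitt_family:
  assumes "finite G" "G \<subseteq> alphabet \<E>"
  shows "leavitt_family R diagonal G S T"
  by (intro leavitt_family.intro leavitt_family_axioms.intro ring_axioms
      diagonal.additive_subgroup_axioms diagonal_mult diagonal_regular diagonal_S T_diagonal T_S_P_diagonal
      S_T_S T_S_T T_S_diff S_closed T_closed)
    (use assms in auto)

section \<open>Monomials, their products with generators, and the regularity of their spans\<close>

definition monomial :: "'a list \<Rightarrow> 'v set \<Rightarrow> 'a list \<Rightarrow> 'r" where
  "monomial \<alpha> A \<beta> = foldr (\<lambda>a x. S a \<otimes> x) \<alpha> (foldr (\<lambda>b x. x \<otimes> T b) \<beta> (P A))"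

text \<open>The words \<open>\<alpha>\<close> and \<open>\<beta>\<close> need not be labels of paths here: the monomials for other words vanish.\<close>

definition monomials :: "int \<Rightarrow> 'r set" where
  "monomials n = {monomial \<alpha> A \<beta> | \<alpha> A \<beta>. set \<alpha> \<subseteq> alphabet \<E> \<and> set \<beta> \<subseteq> alphabet \<E> \<and> A \<in> family \<E> \<and>
    int (length \<alpha>) - int (length \<beta>) = n}"

lemma foldr_T_closed [simp]:
  "set \<beta> \<subseteq> alphabet \<E> \<Longrightarrow> x \<in> carrier R \<Longrightarrow> foldr (\<lambda>b x. x \<otimes> T b) \<beta> x \<in> carrier R"
  by (induction \<beta>) auto

lemma monomial_closed [simp]:
  assumes "set \<alpha> \<subseteq> alphabet \<E>" "set \<beta> \<subseteq> alphabet \<E>" "A \<in> family \<E>"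
  shows "monomial \<alpha> A \<beta> \<in> carrier R"
  using assms(1) unfolding monomial_def by (induction \<alpha>) (auto simp: assms)

lemma monomials_closed: "monomials n \<subseteq> carrier R"
  by (auto simp: monomials_def)

lemma monomial_Cons_left: "monomial (a # \<alpha>) A \<beta> = S a \<otimes> monomial \<alpha> A \<beta>"
  by (simp add: monomial_def)

lemma monomial_Cons_right:
  assumes "set \<alpha> \<subseteq> alphabet \<E>" "set \<beta> \<subseteq> alphabet \<E>" "b \<in> alphabet \<E>" "A \<in> family \<E>"
  shows "monomial \<alpha> A (b # \<beta>) = monomial \<alpha> A \<beta> \<otimes> T b"
  using assms(1)
proof (induction \<alpha>)
  case Nil
  then show ?case by (simp add: monomial_def)
next
  case (Cons a \<alpha>)
  then show ?case using assms by (simp add: monomial_Cons_left m_assoc)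
qed

lemma mult_foldr_T:
  assumes "x \<in> carrier R" "y \<in> carrier R" "set \<beta> \<subseteq> alphabet \<E>"
  shows "x \<otimes> foldr (\<lambda>b x. x \<otimes> T b) \<beta> y = foldr (\<lambda>b x. x \<otimes> T b) \<beta> (x \<otimes> y)"
  using assms by (induction \<beta>) (auto simp: m_assoc[symmetric])

lemma P_mult_monomial:
  assumes "set \<alpha> \<subseteq> alphabet \<E>" "set \<beta> \<subseteq> alphabet \<E>" "A \<in> family \<E>" "B \<in> family \<E>"
  shows "P B \<otimes> monomial \<alpha> A \<beta> = monomial \<alpha> (rel_range \<E> B \<alpha> \<inter> A) \<beta>"
  using assms(1,4)
proof (induction \<alpha> arbitrary: B)
  case Nil
  then show ?case using assms by (simp add: monomial_def mult_foldr_T P_Int)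
next
  case (Cons a \<alpha>)
  have B: "rel_range \<E> B [a] \<in> family \<E>" using Cons.prems by (intro rel_range_family) auto
  have "P B \<otimes> monomial (a # \<alpha>) A \<beta> = S a \<otimes> (P (rel_range \<E> B [a]) \<otimes> monomial \<alpha> A \<beta>)"
    using Cons.prems assms B by (simp add: monomial_Cons_left m_assoc[symmetric] P_S)
  then show ?case
    using Cons B by (simp add: monomial_Cons_left rel_range_Cons[of B a \<alpha>])
qed

lemma monomial_mult_P:
  assumes "set \<alpha> \<subseteq> alphabet \<E>" "set \<beta> \<subseteq> alphabet \<E>" "A \<in> family \<E>" "B \<in> family \<E>"
  shows "monomial \<alpha> A \<beta> \<otimes> P B = monomial \<alpha> (A \<inter> rel_range \<E> B \<beta>) \<beta>"
  using assms(2,4)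
proof (induction \<beta> arbitrary: B)
  case Nil
  from assms(1) Nil show ?case
  proof (induction \<alpha>)
    case Nil
    then show ?case using assms(3) by (simp add: monomial_def P_Int)
  next
    case (Cons a \<alpha>)
    then show ?case using assms(3) by (simp add: monomial_Cons_left m_assoc)
  qed
next
  case (Cons b \<beta>)
  have B: "rel_range \<E> B [b] \<in> family \<E>" using Cons.prems by (intro rel_range_family) auto
  have "monomial \<alpha> A (b # \<beta>) \<otimes> P B = monomial \<alpha> A \<beta> \<otimes> P (rel_range \<E> B [b]) \<otimes> T b"
    using Cons.prems assms B by (simp add: monomial_Cons_right m_assoc T_P)
  moreover have "A \<inter> rel_range \<E> (rel_range \<E> B [b]) \<beta> \<in> family \<E>"
    using assms B Cons.prems by (intro family_Int rel_range_family) auto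
  ultimately show ?case
    using Cons B assms by (simp add: monomial_Cons_right rel_range_Cons[of B b \<beta>])
qed

lemma monomial_empty:
  assumes "set \<alpha> \<subseteq> alphabet \<E>" "set \<beta> \<subseteq> alphabet \<E>"
  shows "monomial \<alpha> {} \<beta> = \<zero>"
proof -
  have "foldr (\<lambda>b x. x \<otimes> T b) \<beta> \<zero> = \<zero>" using assms(2) by (induction \<beta>) auto
  then show ?thesis using assms(1) unfolding monomial_def by (induction \<alpha>) (auto simp: P_empty)
qed

text \<open>The unit is the projection of the vertex set. Multiplying by it on both sides cuts A
  down to the ranges of the two words.\<close>

lemma monomial_in_range:
  assumes "set \<alpha> \<subseteq> alphabet \<E>" "set \<beta> \<subseteq> alphabet \<E>" "A \<in> family \<E>"
  shows "monomial \<alpha> A \<beta> = monomial \<alpha> (word_range \<E> \<alpha> \<inter> A \<inter> word_range \<E> \<beta>) \<beta>"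
proof -
  have "\<one> \<otimes> monomial \<alpha> A \<beta> \<otimes> \<one> = monomial \<alpha> (word_range \<E> \<alpha> \<inter> A \<inter> word_range \<E> \<beta>) \<beta>"
    unfolding P_verts[symmetric] using assms
    by (simp add: P_mult_monomial monomial_mult_P verts_family word_range_def family_Int rel_range_family)
  then show ?thesis using assms by simp
qed

text \<open>A word that labels no path has empty range, so its monomials reduce to
  \<open>P {}\<close> and vanish; this accounts for the extra zero.\<close>

lemma monomials_reduced:
  "monomials n \<subseteq> insert \<zero> {monomial \<alpha> A \<beta> | \<alpha> A \<beta>. \<alpha> \<in> labeled_words \<E> \<and> \<beta> \<in> labeled_words \<E> \<and>
    A \<in> family_below \<E> \<alpha> \<inter> family_below \<E> \<beta> \<and> int (length \<alpha>) - int (length \<beta>) = n}"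
proof
  fix x assume "x \<in> monomials n"
  then obtain \<alpha> A \<beta> where *: "set \<alpha> \<subseteq> alphabet \<E>" "set \<beta> \<subseteq> alphabet \<E>" "A \<in> family \<E>"
      "int (length \<alpha>) - int (length \<beta>) = n" "x = monomial \<alpha> A \<beta>"
    by (auto simp: monomials_def)
  define B where "B = word_range \<E> \<alpha> \<inter> A \<inter> word_range \<E> \<beta>"
  have x: "x = monomial \<alpha> B \<beta>" using * monomial_in_range by (simp add: B_def)
  have B: "B \<in> family_below \<E> \<alpha> \<inter> family_below \<E> \<beta>"
    using * by (auto simp: B_def family_below_def family_Int word_range_family)
  show "x \<in> insert \<zero> {monomial \<alpha> A \<beta> | \<alpha> A \<beta>. \<alpha> \<in> labeled_words \<E> \<and> \<beta> \<in> labeled_words \<E> \<and>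
    A \<in> family_below \<E> \<alpha> \<inter> family_below \<E> \<beta> \<and> int (length \<alpha>) - int (length \<beta>) = n}"
  proof (cases "\<alpha> \<in> labeled_words \<E> \<and> \<beta> \<in> labeled_words \<E>")
    case True
    then show ?thesis using x B *(4) by blast
  next
    case False
    then have "B = {}" by (auto simp: B_def word_range_not_labeled)
    then show ?thesis using x * by (simp add: monomial_empty)
  qed
qed

lemma P_mult_monomials:
  assumes "x \<in> monomials n" "B \<in> family \<E>"
  shows "P B \<otimes> x \<in> monomials n"
proof -
  obtain \<alpha> A \<beta> where *: "set \<alpha> \<subseteq> alphabet \<E>" "set \<beta> \<subseteq> alphabet \<E>" "A \<in> family \<E>"
      "int (length \<alpha>) - int (length \<beta>) = n" "x = monomial \<alpha> A \<beta>"
    using assms by (auto simp: monomials_def)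
  then have "P B \<otimes> x = monomial \<alpha> (rel_range \<E> B \<alpha> \<inter> A) \<beta>"
    using assms(2) by (simp add: P_mult_monomial)
  moreover have "rel_range \<E> B \<alpha> \<inter> A \<in> family \<E>"
    using * assms(2) by (simp add: family_Int rel_range_family)
  ultimately show ?thesis using * unfolding monomials_def by blast
qed

lemma S_mult_monomials:
  assumes "x \<in> monomials n" "a \<in> alphabet \<E>"
  shows "S a \<otimes> x \<in> monomials (1 + n)"
proof -
  obtain \<alpha> A \<beta> where *: "set \<alpha> \<subseteq> alphabet \<E>" "set \<beta> \<subseteq> alphabet \<E>" "A \<in> family \<E>"
      "int (length \<alpha>) - int (length \<beta>) = n" "x = monomial \<alpha> A \<beta>"
    using assms by (auto simp: monomials_def)
  then have "S a \<otimes> x = monomial (a # \<alpha>) A \<beta>" "set (a # \<alpha>) \<subseteq> alphabet \<E>"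
      "int (length (a # \<alpha>)) - int (length \<beta>) = 1 + n"
    using assms(2) by (simp_all add: monomial_Cons_left)
  then show ?thesis using * unfolding monomials_def by blast
qed

lemma T_mult_monomials:
  assumes "x \<in> monomials n" "a \<in> alphabet \<E>"
  shows "T a \<otimes> x \<in> insert \<zero> (monomials (n - 1))"
proof -
  obtain \<alpha> A \<beta> where *: "set \<alpha> \<subseteq> alphabet \<E>" "set \<beta> \<subseteq> alphabet \<E>" "A \<in> family \<E>"
      "int (length \<alpha>) - int (length \<beta>) = n" "x = monomial \<alpha> A \<beta>"
    using assms by (auto simp: monomials_def)
  show ?thesis
  proof (cases \<alpha>)
    case Nil
    \<comment> \<open>The new letter goes to the end of \<beta>, since ghost edges are multiplied in
      reverse order and the leftmost one belongs to the last letter.\<close>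
    have "T a \<otimes> x = monomial [] (rel_range \<E> A [a]) (\<beta> @ [a])"
      using Nil * assms(2) by (simp add: monomial_def mult_foldr_T T_P)
    moreover have "rel_range \<E> A [a] \<in> family \<E>" using * assms by (simp add: rel_range_family)
    moreover have "set [] \<subseteq> alphabet \<E>" "set (\<beta> @ [a]) \<subseteq> alphabet \<E>"
        "int (length []) - int (length (\<beta> @ [a])) = n - 1"
      using * assms Nil by auto
    ultimately show ?thesis unfolding monomials_def by blast
  next
    case (Cons b \<gamma>)
    have x: "T a \<otimes> x = (T a \<otimes> S b) \<otimes> monomial \<gamma> A \<beta>"
      using Cons * assms(2) by (simp add: monomial_Cons_left m_assoc)
    have "int (length \<gamma>) - int (length \<beta>) = n - 1" using * Cons by simp
    then have "monomial \<gamma> A \<beta> \<in> monomials (n - 1)"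
      using * Cons unfolding monomials_def by auto
    then show ?thesis
      using Cons * assms(2) x P_mult_monomials[of "monomial \<gamma> A \<beta>" "n - 1" "word_range \<E> [b]"]
      by (cases "a = b") (auto simp: T_S_same T_S_diff word_range_family)
  qed
qed

lemma monomials_span_regular:
  assumes x: "x \<in> lin_span R (monomials n)"
  shows "\<exists>y\<in>carrier R. x \<otimes> y \<otimes> x = x"
proof -
  let ?cols = "\<lambda>G. leavitt_family.columns R G S T" and ?rows = "\<lambda>G. leavitt_family.rows R G S T"
  let ?level = "\<lambda>G. leavitt_family.level R diagonal G S T"
  \<comment> \<open>Degree n \<ge> 0 means a surplus of edges on the left, hence iterated columns; a
    negative degree means a surplus of ghost edges on the right, hence iterated rows.\<close>
  define layer where "layer G N =
    (if 0 \<le> n then (?cols G ^^ nat n) (?level G N) else (?rows G ^^ nat (- n)) (?level G N))" for G N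
  have layer: "additive_subgroup (layer G N) R" "z \<in> layer G N \<Longrightarrow> c \<odot> z \<in> layer G N"
      "z \<in> layer G N \<Longrightarrow> \<exists>y\<in>carrier R. z \<otimes> y \<otimes> z = z"
    if G: "finite G" "G \<subseteq> alphabet \<E>" for G N z c
  proof -
    interpret leavitt_family R diagonal G S T by (rule leavitt_family[OF G])
    \<comment> \<open>A scalar acts as multiplication by \<open>c \<odot> \<one>\<close>, an element
      of the diagonal: from the left on columns and from the right on rows. This is how the
      contexts, which know only about \<open>D\<close>, give closure under scalars.\<close>
    have "\<one> \<in> diagonal" using P_diagonal[OF verts_family] by (simp add: P_verts)
    then have c: "c \<odot> \<one> \<in> diagonal" by (rule diagonal_smult)
    note cr = regular_context_columns_level[of "nat n" N] regular_context_rows_level[of "nat (- n)" N]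
    show sub: "additive_subgroup (layer G N) R"
      using cr by (simp add: layer_def regular_context_def)
    show "c \<odot> z \<in> layer G N" if z: "z \<in> layer G N"
    proof -
      have "z \<in> carrier R" using z additive_subgroup.a_Hcarr[OF sub] by blast
      then have "c \<odot> z = (c \<odot> \<one>) \<otimes> z" "c \<odot> z = z \<otimes> (c \<odot> \<one>)"
        by (simp_all add: smult_mult mult_smult)
      then show ?thesis
        using cr c z by (cases "0 \<le> n") (force simp: layer_def regular_context_def)+
    qed
    show "\<exists>y\<in>carrier R. z \<otimes> y \<otimes> z = z" if "z \<in> layer G N"
      using that columns_level_regular rows_level_regular by (auto simp: layer_def split: if_splits)
  qed
  define admissible where "admissible G0 N0 G N \<longleftrightarrow> finite G \<and> G0 \<subseteq> G \<and> G \<subseteq> alphabet \<E> \<and> (N0 :: nat) \<le> N"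
    for G0 N0 G N
  \<comment> \<open>Membership is demanded in all sufficiently large layers. Two elements then share
    a layer without a proof that layers increase with G and N.\<close>
  let ?V = "{z \<in> carrier R. \<exists>G0 N0. finite G0 \<and> G0 \<subseteq> alphabet \<E> \<and>
    (\<forall>G N. admissible G0 N0 G N \<longrightarrow> z \<in> layer G N)}"
  have "submodule ?V field_ring R"
  proof (rule submoduleI)
    show "\<zero> \<in> ?V"
      using additive_subgroup.zero_closed[OF layer(1)]
      by (auto simp: admissible_def intro!: exI[of _ "{}"])
  next
    fix z assume "z \<in> ?V"
    then obtain G0 N0 where *: "z \<in> carrier R" "finite G0" "G0 \<subseteq> alphabet \<E>"
      "\<And>G N. admissible G0 N0 G N \<Longrightarrow> z \<in> layer G N" by blast
    have "\<ominus> z \<in> layer G N" "c \<odot> z \<in> layer G N" if "admissible G0 N0 G N" for G N c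
      using *(4)[OF that] that layer(2) additive_subgroup.a_inv_closed[OF layer(1)]
      by (auto simp: admissible_def)
    then show "\<ominus> z \<in> ?V" "c \<odot> z \<in> ?V" for c using *(1-3) smult_closed[of z c] by blast+
  next
    fix y z assume "y \<in> ?V" "z \<in> ?V"
    then obtain G0 N0 G1 N1 where *: "y \<in> carrier R" "finite G0" "G0 \<subseteq> alphabet \<E>"
      "\<And>G N. admissible G0 N0 G N \<Longrightarrow> y \<in> layer G N"
      "z \<in> carrier R" "finite G1" "G1 \<subseteq> alphabet \<E>"
      "\<And>G N. admissible G1 N1 G N \<Longrightarrow> z \<in> layer G N" by blast
    have "y \<oplus> z \<in> layer G N" if a: "admissible (G0 \<union> G1) (max N0 N1) G N" for G N
    proof -
      have "y \<in> layer G N" "z \<in> layer G N"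
        using a by (auto simp: admissible_def intro!: *(4,8))
      then show ?thesis
        using a by (intro additive_subgroup.a_closed[OF layer(1)]) (auto simp: admissible_def)
    qed
    then show "y \<oplus> z \<in> ?V"
      using * by (auto intro!: exI[of _ "G0 \<union> G1"] exI[of _ "max N0 N1"])
  qed auto
  moreover have "monomials n \<subseteq> ?V"
  proof
    fix z assume "z \<in> monomials n"
    then obtain \<alpha> A \<beta> where *: "set \<alpha> \<subseteq> alphabet \<E>" "set \<beta> \<subseteq> alphabet \<E>" "A \<in> family \<E>"
        "int (length \<alpha>) - int (length \<beta>) = n" "z = monomial \<alpha> A \<beta>"
      by (auto simp: monomials_def)
    have "z \<in> layer G N"
      if "admissible (set \<alpha> \<union> set \<beta>) (min (length \<alpha>) (length \<beta>)) G N" for G N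
    proof -
      have G: "finite G" "set \<alpha> \<subseteq> G" "set \<beta> \<subseteq> G" "G \<subseteq> alphabet \<E>" "min (length \<alpha>) (length \<beta>) \<le> N"
        using that by (auto simp: admissible_def)
      interpret leavitt_family R diagonal G S T by (rule leavitt_family) (use G in auto)
      have z: "z = sandwich \<alpha> (P A) \<beta>" by (simp add: *(5) monomial_def sandwich_def)
      show ?thesis
      proof (cases "0 \<le> n")
        case True
        then have "z \<in> (columns ^^ nat n) (level N)"
          unfolding z using G *(3,4) by (intro sandwich_in_columns P_diagonal) auto
        then show ?thesis using True by (simp add: layer_def)
      next
        case False
        then have "z \<in> (rows ^^ nat (- n)) (level N)"
          unfolding z using G *(3,4) by (intro sandwich_in_rows P_diagonal) auto
        then show ?thesis using False by (simp add: layer_def)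
      qed
    qed
    moreover have "finite (set \<alpha> \<union> set \<beta>)" "set \<alpha> \<union> set \<beta> \<subseteq> alphabet \<E>" "z \<in> carrier R" using * by auto
    ultimately show "z \<in> ?V" by blast
  qed
  ultimately have "x \<in> ?V" using lin_span_least x by blast
  then obtain G0 N0 where "finite G0" "G0 \<subseteq> alphabet \<E>" "\<And>G N. admissible G0 N0 G N \<Longrightarrow> x \<in> layer G N"
    by blast
  moreover then have "x \<in> layer G0 N0" by (simp add: admissible_def)
  ultimately show ?thesis using layer(3) by blast
qed

end

section \<open>The grading of the free algebra\<close>

lemma letters_zero [simp]: "letters 0 = []"
  by (simp add: zero_word_def)

lemma letters_plus [simp]: "letters (v + w) = letters v @ letters w"
  by (simp add: plus_word_def)

lemma free_algebra_simps [simp]: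
  "f \<otimes>\<^bsub>free_algebra X\<^esub> g = f * g" "f \<oplus>\<^bsub>free_algebra X\<^esub> g = f + g"
  "\<zero>\<^bsub>free_algebra X\<^esub> = 0" "c \<odot>\<^bsub>free_algebra X\<^esub> f = Poly_Mapping.single 0 c * f"
  by (simp_all add: free_algebra_def)

lemma poly_mapping_sum_single: "f = (\<Sum>w\<in>Poly_Mapping.keys f. Poly_Mapping.single w (Poly_Mapping.lookup f w))"
proof (rule poly_mapping_eqI)
  fix k
  show "Poly_Mapping.lookup f k = Poly_Mapping.lookup (\<Sum>w\<in>Poly_Mapping.keys f. Poly_Mapping.single w (Poly_Mapping.lookup f w)) k"
    by (simp add: lookup_sum lookup_single when_def if_distrib in_keys_iff cong: if_cong)
qed

text \<open>Only words from the support of f occur in the last case. This hands down to single terms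
  what is known of f, such as its degree or its membership in the carrier.\<close>

lemma poly_mapping_single_induct [case_names zero add single]:
  fixes f :: "'b \<Rightarrow>\<^sub>0 'k::comm_monoid_add"
  assumes "Q 0" "\<And>f g. Q f \<Longrightarrow> Q g \<Longrightarrow> Q (f + g)"
    and single: "\<And>w c. w \<in> Poly_Mapping.keys f \<Longrightarrow> Q (Poly_Mapping.single w c)"
  shows "Q f"
proof -
  have "Q (\<Sum>w\<in>W. Poly_Mapping.single w (Poly_Mapping.lookup f w))"
    if "finite W" "W \<subseteq> Poly_Mapping.keys f" for W
    using that by (induction W rule: finite_induct) (auto intro: assms)
  from this[OF finite_keys subset_refl] show ?thesis
    unfolding poly_mapping_sum_single[of f, symmetric] .
qed

lemma free_algebra_carrier_iff:
  "f \<in> carrier (free_algebra X) \<longleftrightarrow> (\<forall>w\<in>Poly_Mapping.keys f. letters w \<noteq> [] \<and> set (letters w) \<subseteq> X)"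
  by (simp add: free_algebra_def)

lemma single_in_free_algebra:
  "letters w \<noteq> [] \<Longrightarrow> set (letters w) \<subseteq> X \<Longrightarrow> Poly_Mapping.single w c \<in> carrier (free_algebra X)"
  by (auto simp: free_algebra_carrier_iff)

lemma free_algebra_closed [simp]:
  fixes f g :: "'g word \<Rightarrow>\<^sub>0 'k::field"
  shows zero_in_free_algebra: "0 \<in> carrier (free_algebra X)"
    and add_in_free_algebra: "f \<in> carrier (free_algebra X) \<Longrightarrow> g \<in> carrier (free_algebra X) \<Longrightarrow> f + g \<in> carrier (free_algebra X)"
    and uminus_in_free_algebra: "f \<in> carrier (free_algebra X) \<Longrightarrow> - f \<in> carrier (free_algebra X)"
    and diff_in_free_algebra: "f \<in> carrier (free_algebra X) \<Longrightarrow> g \<in> carrier (free_algebra X) \<Longrightarrow> f - g \<in> carrier (free_algebra X)"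
    and mult_in_free_algebra: "f \<in> carrier (free_algebra X) \<Longrightarrow> g \<in> carrier (free_algebra X) \<Longrightarrow> f * g \<in> carrier (free_algebra X)"
    and scale_in_free_algebra: "f \<in> carrier (free_algebra X) \<Longrightarrow> Poly_Mapping.single 0 c * f \<in> carrier (free_algebra X)"
    and gen_in_free_algebra: "x \<in> X \<Longrightarrow> (gen x :: 'g word \<Rightarrow>\<^sub>0 'k) \<in> carrier (free_algebra X)"
proof -
  show "0 \<in> carrier (free_algebra X)" by (simp add: free_algebra_carrier_iff)
  show add: "f + g \<in> carrier (free_algebra X)"
    if "f \<in> carrier (free_algebra X)" "g \<in> carrier (free_algebra X)" for f g :: "'g word \<Rightarrow>\<^sub>0 'k"
    using that Poly_Mapping.keys_add[of f g] by (auto simp: free_algebra_carrier_iff subset_iff)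
  show uminus: "- f \<in> carrier (free_algebra X)" if "f \<in> carrier (free_algebra X)" for f :: "'g word \<Rightarrow>\<^sub>0 'k"
    using that by (simp add: free_algebra_carrier_iff in_keys_iff)
  show "f - g \<in> carrier (free_algebra X)" if "f \<in> carrier (free_algebra X)" "g \<in> carrier (free_algebra X)"
    using add[of f "- g"] uminus that by simp
  show "f * g \<in> carrier (free_algebra X)" if "f \<in> carrier (free_algebra X)" "g \<in> carrier (free_algebra X)"
    using that Poly_Mapping.keys_mult[of f g] by (fastforce simp: free_algebra_carrier_iff)
  show "Poly_Mapping.single 0 c * f \<in> carrier (free_algebra X)" if "f \<in> carrier (free_algebra X)"
  proof -
    have "Poly_Mapping.keys (Poly_Mapping.single 0 c * f) \<subseteq> Poly_Mapping.keys f"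
      using Poly_Mapping.keys_mult[of "Poly_Mapping.single 0 c" f] by (auto split: if_splits)
    then show ?thesis using that by (auto simp: free_algebra_carrier_iff)
  qed
  show "(gen x :: 'g word \<Rightarrow>\<^sub>0 'k) \<in> carrier (free_algebra X)" if "x \<in> X"
    using that by (simp add: gen_def single_in_free_algebra)
qed

lemma sum_in_free_algebra:
  "(\<And>i. i \<in> A \<Longrightarrow> f i \<in> carrier (free_algebra X)) \<Longrightarrow> sum f A \<in> carrier (free_algebra X)"
  by (induction A rule: infinite_finite_induct) auto

lemma scale_uminus: "Poly_Mapping.single 0 (- 1) * f = - (f :: 'g word \<Rightarrow>\<^sub>0 'k::field)"
proof -
  have "Poly_Mapping.single (0 :: 'g word) (- 1 :: 'k) = - 1"
    by (simp add: single_uminus flip: single_one)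
  then show ?thesis by simp
qed

lemma scale_scale:
  "Poly_Mapping.single 0 b * (Poly_Mapping.single 0 c * f) =
    Poly_Mapping.single 0 (b * c) * (f :: 'g word \<Rightarrow>\<^sub>0 'k::field)"
  by (simp add: mult_single mult.assoc[symmetric])

lemma scale_commute: "f * Poly_Mapping.single 0 c = Poly_Mapping.single 0 c * (f :: 'g word \<Rightarrow>\<^sub>0 'k::field)"
  by (induction f rule: poly_mapping_single_induct)
    (simp_all add: distrib_left distrib_right mult_single mult.commute)

lemma module_free_algebra: "module field_ring (free_algebra X :: ('k::field, 'g word \<Rightarrow>\<^sub>0 'k) module)"
proof (rule moduleI[OF cring_field_ring])
  show "abelian_group (free_algebra X :: ('k, 'g word \<Rightarrow>\<^sub>0 'k) module)"
  proof (rule abelian_groupI)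
    fix f :: "'g word \<Rightarrow>\<^sub>0 'k" assume "f \<in> carrier (free_algebra X)"
    then show "\<exists>g\<in>carrier (free_algebra X). g \<oplus>\<^bsub>free_algebra X\<^esub> f = \<zero>\<^bsub>free_algebra X\<^esub>"
      by (intro bexI[of _ "- f"]) simp_all
  qed (simp_all add: algebra_simps)
qed (simp_all add: algebra_simps single_add scale_scale)

lemma a_inv_free_algebra [simp]:
  assumes "f \<in> carrier (free_algebra X)"
  shows "\<ominus>\<^bsub>free_algebra X\<^esub> f = - (f :: 'g word \<Rightarrow>\<^sub>0 'k::field)"
proof -
  interpret module field_ring "free_algebra X :: ('k, 'g word \<Rightarrow>\<^sub>0 'k) module" by (rule module_free_algebra)
  show ?thesis by (rule M.minus_equality) (use assms in simp_all)
qed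

text \<open>Closure under negation comes from the scalar -1.\<close>

lemma submodule_free_algebraI:
  fixes H :: "('g word \<Rightarrow>\<^sub>0 'k::field) set"
  assumes "H \<subseteq> carrier (free_algebra X)" "0 \<in> H" "\<And>f g. f \<in> H \<Longrightarrow> g \<in> H \<Longrightarrow> f + g \<in> H"
    and scale: "\<And>c f. f \<in> H \<Longrightarrow> Poly_Mapping.single 0 c * f \<in> H"
  shows "submodule H field_ring (free_algebra X)"
proof -
  interpret module field_ring "free_algebra X :: ('k, 'g word \<Rightarrow>\<^sub>0 'k) module" by (rule module_free_algebra)
  show ?thesis
  proof (rule submoduleI)
    fix f assume f: "f \<in> H"
    then have "\<ominus>\<^bsub>free_algebra X\<^esub> f = - f" using assms(1) by auto
    then show "\<ominus>\<^bsub>free_algebra X\<^esub> f \<in> H" using scale[OF f, of "- 1"] by (simp add: scale_uminus)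
  qed (use assms in auto)
qed

lemma submodule_free_algebraD:
  fixes H :: "('g word \<Rightarrow>\<^sub>0 'k::field) set"
  assumes "submodule H field_ring (free_algebra X)"
  shows "H \<subseteq> carrier (free_algebra X)" "0 \<in> H" "f \<in> H \<Longrightarrow> g \<in> H \<Longrightarrow> f + g \<in> H"
    "f \<in> H \<Longrightarrow> Poly_Mapping.single 0 c * f \<in> H" "f \<in> H \<Longrightarrow> - f \<in> H"
proof -
  interpret module field_ring "free_algebra X :: ('k, 'g word \<Rightarrow>\<^sub>0 'k) module" by (rule module_free_algebra)
  note E = submoduleE[OF assms, simplified]
  show "H \<subseteq> carrier (free_algebra X)" "f \<in> H \<Longrightarrow> g \<in> H \<Longrightarrow> f + g \<in> H"
    and scale: "f \<in> H \<Longrightarrow> Poly_Mapping.single 0 c * f \<in> H" for c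
    using E by auto
  show "0 \<in> H" using additive_subgroup.zero_closed[OF submodule_additive_subgroup[OF assms]] by simp
  show "f \<in> H \<Longrightarrow> - f \<in> H" using scale[of "- 1"] by (simp add: scale_uminus)
qed

lemma algebra_idealD:
  fixes J :: "('g word \<Rightarrow>\<^sub>0 'k::field) set"
  assumes "algebra_ideal (free_algebra X) J"
  shows "J \<subseteq> carrier (free_algebra X)" "0 \<in> J" "f \<in> J \<Longrightarrow> g \<in> J \<Longrightarrow> f + g \<in> J"
    "f \<in> J \<Longrightarrow> Poly_Mapping.single 0 c * f \<in> J" "f \<in> J \<Longrightarrow> - f \<in> J"
    "x \<in> carrier (free_algebra X) \<Longrightarrow> f \<in> J \<Longrightarrow> x * f \<in> J"
    "x \<in> carrier (free_algebra X) \<Longrightarrow> f \<in> J \<Longrightarrow> f * x \<in> J"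
proof -
  have J: "submodule J field_ring (free_algebra X)"
    using assms by (simp add: algebra_ideal_def)
  show "J \<subseteq> carrier (free_algebra X)" "0 \<in> J" "f \<in> J \<Longrightarrow> g \<in> J \<Longrightarrow> f + g \<in> J"
    "f \<in> J \<Longrightarrow> Poly_Mapping.single 0 c * f \<in> J" "f \<in> J \<Longrightarrow> - f \<in> J"
    by (rule submodule_free_algebraD[OF J]; assumption)+
  show "x \<in> carrier (free_algebra X) \<Longrightarrow> f \<in> J \<Longrightarrow> x * f \<in> J"
    "x \<in> carrier (free_algebra X) \<Longrightarrow> f \<in> J \<Longrightarrow> f * x \<in> J"
    using assms by (simp_all add: algebra_ideal_def)
qed

section \<open>Degrees and homogeneous parts\<close>

definition hom_part :: "('b \<Rightarrow> int) \<Rightarrow> int \<Rightarrow> ('b \<Rightarrow>\<^sub>0 'k::comm_monoid_add) \<Rightarrow> 'b \<Rightarrow>\<^sub>0 'k" where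
  "hom_part \<delta> n f = Poly_Mapping.mapp (\<lambda>w c. if \<delta> w = n then c else 0) f"

lemma lookup_hom_part: "Poly_Mapping.lookup (hom_part \<delta> n f) w = (if \<delta> w = n then Poly_Mapping.lookup f w else 0)"
  by (simp add: hom_part_def lookup_mapp when_def in_keys_iff)

lemma hom_part_add: "hom_part \<delta> n (f + g) = hom_part \<delta> n f + hom_part \<delta> n g"
  by (rule poly_mapping_eqI) (simp add: lookup_hom_part lookup_add)

lemma hom_part_zero [simp]: "hom_part \<delta> n 0 = 0"
  by (rule poly_mapping_eqI) (simp add: lookup_hom_part)

lemma hom_part_sum: "hom_part \<delta> n (sum f A) = (\<Sum>i\<in>A. hom_part \<delta> n (f i))"
  by (induction A rule: infinite_finite_induct) (simp_all add: hom_part_add)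

lemma hom_part_diff:
  "hom_part \<delta> n (f - g) = hom_part \<delta> n f - hom_part \<delta> n (g :: 'b \<Rightarrow>\<^sub>0 'k::ab_group_add)"
  by (rule poly_mapping_eqI) (simp add: lookup_hom_part lookup_minus)

lemma hom_part_single: "hom_part \<delta> n (Poly_Mapping.single w c) = (if \<delta> w = n then Poly_Mapping.single w c else 0)"
  by (rule poly_mapping_eqI) (auto simp: lookup_hom_part lookup_single when_def)

lemma keys_hom_part: "Poly_Mapping.keys (hom_part \<delta> n f) = {w \<in> Poly_Mapping.keys f. \<delta> w = n}"
  by (auto simp: in_keys_iff lookup_hom_part split: if_splits)

lemma hom_part_homogeneous:
  assumes "\<And>w. w \<in> Poly_Mapping.keys f \<Longrightarrow> \<delta> w = d"
  shows "hom_part \<delta> n f = (if n = d then f else 0)"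
  using assms by (intro poly_mapping_eqI) (auto simp: lookup_hom_part in_keys_iff)

lemma sum_hom_part:
  assumes "finite N" "\<delta> ` Poly_Mapping.keys f \<subseteq> N"
  shows "(\<Sum>n\<in>N. hom_part \<delta> n f) = f"
  by (rule poly_mapping_eqI) (use assms in \<open>auto simp: lookup_sum lookup_hom_part in_keys_iff image_subset_iff\<close>)

text \<open>A single word shifts degrees. For a general factor this is applied to its terms one by
  one.\<close>

lemma hom_part_mult_single:
  fixes f :: "'b::monoid_add \<Rightarrow>\<^sub>0 'k::comm_ring_1"
  assumes "\<And>v w. \<delta> (v + w) = \<delta> v + \<delta> w"
  shows "hom_part \<delta> n (Poly_Mapping.single w c * f) = Poly_Mapping.single w c * hom_part \<delta> (n - \<delta> w) f"
    and "hom_part \<delta> n (f * Poly_Mapping.single w c) = hom_part \<delta> (n - \<delta> w) f * Poly_Mapping.single w c"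
  by (induction f rule: poly_mapping_single_induct)
    (auto simp: distrib_left distrib_right hom_part_add mult_single hom_part_single assms)

fun gen_degree :: "('v, 'a) lpa_gen \<Rightarrow> int" where
  "gen_degree (Proj A) = 0"
| "gen_degree (Edge a) = 1"
| "gen_degree (Ghost a) = - 1"

definition word_degree :: "('v, 'a) lpa_gen word \<Rightarrow> int" where
  "word_degree w = sum_list (map gen_degree (letters w))"

lemma word_degree_plus: "word_degree (v + w) = word_degree v + word_degree w"
  by (simp add: word_degree_def)

lemma word_degree_zero [simp]: "word_degree 0 = 0"
  by (simp add: word_degree_def)

definition homogeneous :: "int \<Rightarrow> (('v, 'a) lpa_gen word \<Rightarrow>\<^sub>0 'k::zero) \<Rightarrow> bool" where
  "homogeneous n f \<longleftrightarrow> (\<forall>w\<in>Poly_Mapping.keys f. word_degree w = n)"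

lemma homogeneous_zero [simp]: "homogeneous n 0"
  by (simp add: homogeneous_def)

lemma homogeneous_gen: "homogeneous (gen_degree x) (gen x)"
  by (simp add: homogeneous_def gen_def word_degree_def)

lemma homogeneous_add: "homogeneous n f \<Longrightarrow> homogeneous n g \<Longrightarrow> homogeneous n (f + g)"
  using Poly_Mapping.keys_add[of f g] by (auto simp: homogeneous_def)

lemma homogeneous_diff:
  "homogeneous n f \<Longrightarrow> homogeneous n g \<Longrightarrow> homogeneous n (f - g)" for f :: "_ \<Rightarrow>\<^sub>0 'k::field"
  by (auto simp: homogeneous_def in_keys_iff lookup_minus)

lemma homogeneous_mult:
  fixes f g :: "_ \<Rightarrow>\<^sub>0 'k::field"
  assumes "homogeneous m f" "homogeneous n g"
  shows "homogeneous (m + n) (f * g)"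
  unfolding homogeneous_def
proof
  fix w assume "w \<in> Poly_Mapping.keys (f * g)"
  then obtain u v where "w = u + v" "u \<in> Poly_Mapping.keys f" "v \<in> Poly_Mapping.keys g"
    using Poly_Mapping.keys_mult[of f g] by auto
  then show "word_degree w = m + n" using assms by (simp add: homogeneous_def word_degree_plus)
qed

lemma homogeneous_sum:
  "(\<And>i. i \<in> A \<Longrightarrow> homogeneous n (f i)) \<Longrightarrow> homogeneous n (sum f A)"
  by (induction A rule: infinite_finite_induct) (auto simp: homogeneous_add)

lemma homogeneous_scale: "homogeneous n f \<Longrightarrow> homogeneous n (Poly_Mapping.single 0 c * f)"
  for f :: "_ \<Rightarrow>\<^sub>0 'k::field"
  using homogeneous_mult[of 0 "Poly_Mapping.single 0 c" n f] by (simp add: homogeneous_def)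

lemma homogeneous_hom_part: "homogeneous n (hom_part word_degree n f)"
  by (simp add: homogeneous_def keys_hom_part)

lemma hom_part_in_free_algebra:
  "f \<in> carrier (free_algebra X) \<Longrightarrow> hom_part \<delta> n f \<in> carrier (free_algebra X)"
  by (simp add: free_algebra_carrier_iff keys_hom_part)

section \<open>The quotient by the relations\<close>

text \<open>The type argument \<open>K\<close> only names the field.\<close>

locale leavitt_labeled_path_algebra = normal_labeled_space \<E>
  for \<E> :: "('v, 'e, 'a) labeled_space" +
  fixes K :: "'k::field itself"
begin

abbreviation F :: "('k, ('v, 'a) lpa_gen word \<Rightarrow>\<^sub>0 'k) module" where
  "F \<equiv> free_algebra (lpa_gens \<E>)"

abbreviation I :: "(('v, 'a) lpa_gen word \<Rightarrow>\<^sub>0 'k) set" where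
  "I \<equiv> lpa_ideal \<E>"

abbreviation L :: "('k, (('v, 'a) lpa_gen word \<Rightarrow>\<^sub>0 'k) set) module" where
  "L \<equiv> LPA \<E>"

abbreviation cl :: "(('v, 'a) lpa_gen word \<Rightarrow>\<^sub>0 'k) \<Rightarrow> (('v, 'a) lpa_gen word \<Rightarrow>\<^sub>0 'k) set" where
  "cl \<equiv> lpa_class \<E>"

section \<open>The ideal of relations and its homogeneity\<close>

lemma gens_iff [simp]:
  "Proj A \<in> lpa_gens \<E> \<longleftrightarrow> A \<in> family \<E>" "Edge a \<in> lpa_gens \<E> \<longleftrightarrow> a \<in> alphabet \<E>"
  "Ghost a \<in> lpa_gens \<E> \<longleftrightarrow> a \<in> alphabet \<E>"
  by (auto simp: lpa_gens_def)

lemma relation_in_free_algebra: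
  "r \<in> lpa_relations \<E> \<Longrightarrow> r \<in> carrier F"
proof (induction r rule: lpa_relations.induct)
  case (proj_regular A)
  \<comment> \<open>The empty set counts as regular by convention; it belongs to the family as a
    relative complement.\<close>
  then have A: "A \<in> family \<E>" using empty_family by (auto simp: regular_sets_def)
  then show ?case
    using out_labels_alphabet[of A] rel_range_family[OF A, of "[_]"]
    by (intro diff_in_free_algebra sum_in_free_algebra mult_in_free_algebra gen_in_free_algebra) auto
qed (auto simp: family_Int family_Un empty_family rel_range_family word_range_family)

lemma relation_homogeneous:
  fixes r :: "('v, 'a) lpa_gen word \<Rightarrow>\<^sub>0 'k::field"
  shows "r \<in> lpa_relations \<E> \<Longrightarrow> \<exists>n. homogeneous n r"
proof (induction r rule: lpa_relations.induct)
  have gen0: "homogeneous 0 (gen (Proj A) :: ('v, 'a) lpa_gen word \<Rightarrow>\<^sub>0 'k)" for A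
    using homogeneous_gen[of "Proj A"] by simp
  have gen1: "homogeneous 1 (gen (Edge a) :: ('v, 'a) lpa_gen word \<Rightarrow>\<^sub>0 'k)"
      "homogeneous (- 1) (gen (Ghost a) :: ('v, 'a) lpa_gen word \<Rightarrow>\<^sub>0 'k)" for a
    using homogeneous_gen[of "Edge a"] homogeneous_gen[of "Ghost a"] by simp_all
  note gens = gen0 gen1
  note prod = homogeneous_mult[OF gen0 gen0, simplified] homogeneous_mult[OF gen0 gen1(1), simplified]
    homogeneous_mult[OF gen1(1) gen0, simplified] homogeneous_mult[OF gen1(2) gen0, simplified]
    homogeneous_mult[OF gen0 gen1(2), simplified] homogeneous_mult[OF gen1(2) gen1(1), simplified]
    homogeneous_mult[OF gen1(1) gen1(2), simplified]
  note prod3 = homogeneous_mult[OF prod(7) gen1(1), simplified]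
    homogeneous_mult[OF prod(6) gen1(2), simplified] homogeneous_mult[OF prod(3) gen1(2), simplified]
  {
    case (proj_Int A B) then show ?case using gens prod by (blast intro: homogeneous_diff)
  next
    case (proj_Un A B) then show ?case using gens by (blast intro: homogeneous_diff homogeneous_add)
  next
    case proj_empty then show ?case using gens by blast
  next
    case (proj_edge A a) then show ?case using prod by (blast intro: homogeneous_diff)
  next
    case (ghost_proj A a) then show ?case using prod by (blast intro: homogeneous_diff)
  next
    case (ghost_edge a) then show ?case using gens prod by (blast intro: homogeneous_diff)
  next
    case (ghost_edge_neq a b) then show ?case using prod by blast
  next
    case (edge_ghost_edge a) then show ?case using gens prod3 by (blast intro: homogeneous_diff)
  next
    case (ghost_edge_ghost a) then show ?case using gens prod3 by (blast intro: homogeneous_diff)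
  next
    case (proj_regular A)
    then show ?case using gens prod3 by (blast intro: homogeneous_diff homogeneous_sum)
  }
qed

lemma algebra_ideal_I: "algebra_ideal F I" and relation_in_I: "r \<in> lpa_relations \<E> \<Longrightarrow> r \<in> I"
proof -
  define \<J> where "\<J> = {J. algebra_ideal F J \<and> lpa_relations \<E> \<subseteq> J}"
  have I: "I = \<Inter> \<J>" by (simp add: lpa_ideal_def gen_algebra_ideal_def \<J>_def)
  then show "r \<in> lpa_relations \<E> \<Longrightarrow> r \<in> I" by (auto simp: \<J>_def)
  have \<J>: "algebra_ideal F J" if "J \<in> \<J>" for J using that by (simp add: \<J>_def)
  \<comment> \<open>The carrier is thus one of the ideals intersected in \<open>I\<close>, which
    keeps \<open>I\<close> inside the carrier.\<close>
  have "algebra_ideal F (carrier F)"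
    by (auto simp: algebra_ideal_def intro!: submodule_free_algebraI)
  then have carrier: "carrier F \<in> \<J>" using relation_in_free_algebra by (auto simp: \<J>_def)
  show "algebra_ideal F I"
    unfolding algebra_ideal_def
  proof (intro conjI ballI)
    show "submodule I field_ring F"
    proof (rule submodule_free_algebraI)
      show "I \<subseteq> carrier F" using carrier unfolding I by blast
      show "0 \<in> I" unfolding I using algebra_idealD(2)[OF \<J>] by blast
      show "f + g \<in> I" if "f \<in> I" "g \<in> I" for f g
        using that algebra_idealD(3)[OF \<J>, of _ f g] unfolding I by blast
      show "Poly_Mapping.single 0 c * f \<in> I" if "f \<in> I" for c f
        using that algebra_idealD(4)[OF \<J>, of _ f c] unfolding I by blast
    qed
  next
    fix x f assume "x \<in> carrier F" "f \<in> I"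
    then show "x \<otimes>\<^bsub>F\<^esub> f \<in> I" "f \<otimes>\<^bsub>F\<^esub> x \<in> I"
      unfolding I using algebra_idealD(6,7)[OF \<J>] by auto
  qed
qed

lemma
  shows I_subset: "I \<subseteq> carrier F" and I_zero [simp]: "0 \<in> I"
    and I_add: "f \<in> I \<Longrightarrow> g \<in> I \<Longrightarrow> f + g \<in> I"
    and I_scale: "f \<in> I \<Longrightarrow> Poly_Mapping.single 0 c * f \<in> I"
    and I_uminus: "f \<in> I \<Longrightarrow> - f \<in> I"
    and I_mult_left: "x \<in> carrier F \<Longrightarrow> f \<in> I \<Longrightarrow> x * f \<in> I"
    and I_mult_right: "x \<in> carrier F \<Longrightarrow> f \<in> I \<Longrightarrow> f * x \<in> I"
  by (rule algebra_idealD[OF algebra_ideal_I]; assumption)+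

lemma least_ideal: "algebra_ideal F J \<Longrightarrow> lpa_relations \<E> \<subseteq> J \<Longrightarrow> I \<subseteq> J"
  by (auto simp: lpa_ideal_def gen_algebra_ideal_def)

text \<open>The polynomials all of whose homogeneous parts lie in \<open>I\<close> form an ideal. It
  contains the relations, each being homogeneous, and therefore contains \<open>I\<close>.\<close>

lemma hom_part_ideal:
  assumes "f \<in> I"
  shows "hom_part word_degree n f \<in> I"
proof -
  let ?J = "{f \<in> carrier F. \<forall>n. hom_part word_degree n f \<in> I}"
  have "algebra_ideal F ?J"
    unfolding algebra_ideal_def
  proof (intro conjI ballI)
    show "submodule ?J field_ring F"
      by (rule submodule_free_algebraI)
        (auto simp: hom_part_add I_add hom_part_mult_single[OF word_degree_plus] I_scale)
  next
    fix x f assume x: "x \<in> carrier F" and f: "f \<in> ?J"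
    have "\<forall>n. hom_part word_degree n (x * f) \<in> I \<and> hom_part word_degree n (f * x) \<in> I"
    proof (induction x rule: poly_mapping_single_induct)
      case (single w c)
      then have "Poly_Mapping.single w c \<in> carrier F"
        using x by (intro single_in_free_algebra) (auto simp: free_algebra_carrier_iff)
      then show ?case
        using f by (simp add: hom_part_mult_single[OF word_degree_plus] I_mult_left I_mult_right)
    qed (auto simp: distrib_left distrib_right hom_part_add I_add)
    then show "x \<otimes>\<^bsub>F\<^esub> f \<in> ?J" "f \<otimes>\<^bsub>F\<^esub> x \<in> ?J" using x f by simp_all
  qed
  moreover have "lpa_relations \<E> \<subseteq> ?J"
  proof
    fix r :: "('v, 'a) lpa_gen word \<Rightarrow>\<^sub>0 'k" assume r: "r \<in> lpa_relations \<E>"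
    then obtain d where "homogeneous d r" using relation_homogeneous by blast
    then have "hom_part word_degree n r = (if n = d then r else 0)" for n
      by (intro hom_part_homogeneous) (simp add: homogeneous_def)
    then show "r \<in> ?J" using r by (simp add: relation_in_free_algebra relation_in_I)
  qed
  ultimately show ?thesis using least_ideal assms by blast
qed

section \<open>Cosets and the operations on them\<close>

lemma cl_def: "cl f = {i + f | i. i \<in> I}"
  by (auto simp: lpa_class_def a_r_coset_def')

lemma cl_self: "f \<in> cl f"
  unfolding cl_def by (rule CollectI, rule exI[of _ 0]) simp

lemma cl_eq_iff: "cl f = cl g \<longleftrightarrow> f - g \<in> I"
proof
  assume "cl f = cl g"
  then obtain i where "i \<in> I" "f = i + g" using cl_self[of f] by (auto simp: cl_def)
  then show "f - g \<in> I" by simp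
next
  assume fg: "f - g \<in> I"
  have "x \<in> cl b" if x: "x \<in> cl a" and ab: "a - b \<in> I" for x a b
  proof -
    obtain i where "i \<in> I" "x = i + a" using x by (auto simp: cl_def)
    then have "x = (i + (a - b)) + b" "i + (a - b) \<in> I" using ab by (auto simp: I_add)
    then show ?thesis unfolding cl_def by blast
  qed
  then show "cl f = cl g" using fg I_uminus[OF fg] by auto
qed

lemma in_cl_iff: "h \<in> cl f \<longleftrightarrow> h - f \<in> I"
proof
  assume "h - f \<in> I"
  then have "(h - f) + f \<in> cl f" unfolding cl_def by blast
  then show "h \<in> cl f" by simp
qed (auto simp: cl_def)

lemma L_carrier: "carrier L = cl ` carrier F"
  by (auto simp: LPA_def Let_def A_RCOSETS_def' lpa_class_def)

lemma L_zero: "\<zero>\<^bsub>L\<^esub> = cl 0"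
  by (auto simp: LPA_def Let_def cl_def)

lemma L_one: "\<one>\<^bsub>L\<^esub> = cl (gen (Proj (verts (digraph_of \<E>))))"
  by (simp add: LPA_def Let_def)

lemma L_add [simp]: "cl f \<oplus>\<^bsub>L\<^esub> cl g = cl (f + g)"
proof -
  have "cl f \<oplus>\<^bsub>L\<^esub> cl g = (\<Union>h\<in>cl f. \<Union>k\<in>cl g. {h + k})"
    by (simp add: LPA_def Let_def set_add_def')
  also have "\<dots> = cl (f + g)"
  proof (intro equalityI subsetI)
    fix x assume "x \<in> (\<Union>h\<in>cl f. \<Union>k\<in>cl g. {h + k})"
    then obtain h k where "h - f \<in> I" "k - g \<in> I" "x = h + k" by (auto simp: in_cl_iff)
    then show "x \<in> cl (f + g)" using I_add[of "h - f" "k - g"] by (simp add: in_cl_iff algebra_simps)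
  next
    fix x assume "x \<in> cl (f + g)"
    then have "x - g \<in> cl f" by (simp add: in_cl_iff algebra_simps)
    moreover have "x = (x - g) + g" by simp
    ultimately show "x \<in> (\<Union>h\<in>cl f. \<Union>k\<in>cl g. {h + k})" using cl_self[of g] by blast
  qed
  finally show ?thesis .
qed

text \<open>The carrier conditions matter: the type also has polynomials with a constant term or
  with letters that are no generators, and \<open>I\<close> absorbs products only with elements of
  the carrier.\<close>

lemma L_mult [simp]:
  assumes "f \<in> carrier F" "g \<in> carrier F"
  shows "cl f \<otimes>\<^bsub>L\<^esub> cl g = cl (f * g)"
proof -
  have "cl f \<otimes>\<^bsub>L\<^esub> cl g = (\<Union>h\<in>cl f. \<Union>k\<in>cl g. cl (h * k))"
    by (simp add: LPA_def Let_def rcoset_mult_def lpa_class_def)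
  also have "\<dots> = (\<Union>h\<in>cl f. \<Union>k\<in>cl g. cl (f * g))"
  proof (intro SUP_cong refl)
    fix h k assume "h \<in> cl f" "k \<in> cl g"
    then have hk: "h - f \<in> I" "k - g \<in> I" by (auto simp: in_cl_iff)
    have "(k - g) + g \<in> carrier F" using hk I_subset assms by (intro add_in_free_algebra) auto
    then have "k \<in> carrier F" by simp
    then have "(h - f) * k + f * (k - g) \<in> I"
      using hk assms by (intro I_add I_mult_left I_mult_right)
    then show "cl (h * k) = cl (f * g)" by (simp add: cl_eq_iff algebra_simps)
  qed
  also have "\<dots> = cl (f * g)" using cl_self by blast
  finally show ?thesis .
qed

lemma L_smult [simp]: "c \<odot>\<^bsub>L\<^esub> cl f = cl (Poly_Mapping.single 0 c * f)"
proof -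
  have "c \<odot>\<^bsub>L\<^esub> cl f = (\<Union>h\<in>cl f. cl (Poly_Mapping.single 0 c * h))"
    by (simp add: LPA_def Let_def lpa_class_def)
  also have "\<dots> = (\<Union>h\<in>cl f. cl (Poly_Mapping.single 0 c * f))"
    by (intro SUP_cong refl) (simp add: cl_eq_iff in_cl_iff I_scale flip: right_diff_distrib)
  also have "\<dots> = cl (Poly_Mapping.single 0 c * f)" using cl_self by blast
  finally show ?thesis .
qed

lemma cl_relation: "f - g \<in> lpa_relations \<E> \<Longrightarrow> cl f = cl g"
  by (simp add: cl_eq_iff relation_in_I)

lemma cl_mult_cong:
  assumes "cl f = cl f'" "cl g = cl g'" "f \<in> carrier F" "f' \<in> carrier F" "g \<in> carrier F" "g' \<in> carrier F"
  shows "cl (f * g) = cl (f' * g')"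
  using assms by (metis L_mult)

lemma
  assumes "a \<in> alphabet \<E>"
  shows cl_ghost_edge: "cl (gen (Ghost a) * gen (Edge a)) = cl (gen (Proj (word_range \<E> [a])))"
    and cl_edge_ghost_edge: "cl (gen (Edge a) * gen (Ghost a) * gen (Edge a)) = cl (gen (Edge a))"
    and cl_ghost_edge_ghost: "cl (gen (Ghost a) * gen (Edge a) * gen (Ghost a)) = cl (gen (Ghost a))"
  by (intro cl_relation lpa_relations.intros assms)+

lemma
  assumes "A \<in> family \<E>"
  shows cl_proj_Int: "B \<in> family \<E> \<Longrightarrow> cl (gen (Proj A) * gen (Proj B)) = cl (gen (Proj (A \<inter> B)))"
    and cl_proj_edge: "a \<in> alphabet \<E> \<Longrightarrow> cl (gen (Proj A) * gen (Edge a)) = cl (gen (Edge a) * gen (Proj (rel_range \<E> A [a])))"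
    and cl_ghost_proj: "a \<in> alphabet \<E> \<Longrightarrow> cl (gen (Ghost a) * gen (Proj A)) = cl (gen (Proj (rel_range \<E> A [a])) * gen (Ghost a))"
  by (rule cl_relation[symmetric], intro lpa_relations.intros assms, assumption)
     (rule cl_relation, intro lpa_relations.intros assms, assumption)+

section \<open>The projection of the vertex set as unit\<close>

abbreviation unit :: "('v, 'a) lpa_gen word \<Rightarrow>\<^sub>0 'k" where
  "unit \<equiv> gen (Proj (verts (digraph_of \<E>)))"

lemma unit_in_F [simp]: "unit \<in> carrier F"
  by (simp add: verts_family)

text \<open>For a letter a the relations give s_a = s_a s_a^* s_a = s_a p_{r(a)}. On the right,
  p_{r(a)} absorbs the unit; on the left, the unit moves past s_a and turns into p_{r(a)}. Ghost
  edges are symmetric.\<close>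

lemma unit_gen:
  assumes "x \<in> lpa_gens \<E>"
  shows "cl (unit * gen x) = cl (gen x)" "cl (gen x * unit) = cl (gen x)"
proof -
  let ?V = "verts (digraph_of \<E>)"
  have "cl (unit * gen x) = cl (gen x) \<and> cl (gen x * unit) = cl (gen x)"
  proof (cases x)
    case (Proj A)
    then have A: "A \<in> family \<E>" and sub: "A \<subseteq> ?V" using assms family_subset by auto
    then show ?thesis
      using cl_proj_Int[OF A verts_family] cl_proj_Int[OF verts_family A] Proj
      by (simp add: Int_absorb1 Int_absorb2)
  next
    case (Edge a)
    then have a: "a \<in> alphabet \<E>" using assms by auto
    let ?s = "gen (Edge a) :: ('v, 'a) lpa_gen word \<Rightarrow>\<^sub>0 'k" and ?t = "gen (Ghost a) :: ('v, 'a) lpa_gen word \<Rightarrow>\<^sub>0 'k"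
      and ?p = "gen (Proj (word_range \<E> [a])) :: ('v, 'a) lpa_gen word \<Rightarrow>\<^sub>0 'k"
    have r: "word_range \<E> [a] \<in> family \<E>" using a by (simp add: word_range_family)
    note [simp] = a r
    have sp: "cl (?s * ?p) = cl ?s"
      using cl_mult_cong[OF refl cl_ghost_edge[OF a], of ?s] cl_edge_ghost_edge[OF a] by (simp add: mult.assoc)
    have 1: "cl (unit * ?s) = cl ?s"
      using cl_proj_edge[OF verts_family a] sp by (simp add: word_range_def)
    have pu: "cl (?p * unit) = cl ?p"
      using cl_proj_Int[OF r verts_family] family_subset[OF r] by (simp add: Int_absorb2)
    have "cl (?s * unit) = cl (?s * ?p * unit)" by (rule cl_mult_cong) (simp_all add: sp)
    also have "\<dots> = cl (?s * ?p)"
      using cl_mult_cong[OF refl pu, of ?s] by (simp add: mult.assoc)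
    finally show ?thesis using 1 Edge sp by simp
  next
    case (Ghost a)
    then have a: "a \<in> alphabet \<E>" using assms by auto
    let ?t = "gen (Ghost a) :: ('v, 'a) lpa_gen word \<Rightarrow>\<^sub>0 'k"
      and ?p = "gen (Proj (word_range \<E> [a])) :: ('v, 'a) lpa_gen word \<Rightarrow>\<^sub>0 'k"
    have r: "word_range \<E> [a] \<in> family \<E>" using a by (simp add: word_range_family)
    note [simp] = a r
    have pt: "cl (?p * ?t) = cl ?t"
      using cl_mult_cong[OF cl_ghost_edge[OF a] refl, of ?t] cl_ghost_edge_ghost[OF a] by simp
    have 1: "cl (?t * unit) = cl ?t"
      using cl_ghost_proj[OF verts_family a] pt by (simp add: word_range_def)
    have up: "cl (unit * ?p) = cl ?p"
      using cl_proj_Int[OF verts_family r] family_subset[OF r] by (simp add: Int_absorb1)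
    have "cl (unit * ?t) = cl (unit * (?p * ?t))" by (rule cl_mult_cong) (simp_all add: pt)
    also have "\<dots> = cl (?p * ?t)"
      using cl_mult_cong[OF up refl, of ?t] by (simp add: mult.assoc)
    finally show ?thesis using 1 Ghost pt by simp
  qed
  then show "cl (unit * gen x) = cl (gen x)" "cl (gen x * unit) = cl (gen x)" by simp_all
qed

lemma single_Cons: "Poly_Mapping.single (Word (x # ls)) c = gen x * Poly_Mapping.single (Word ls) (c :: 'k)"
  by (simp add: gen_def mult_single plus_word_def)

lemma single_snoc: "Poly_Mapping.single (Word (ls @ [x])) c = Poly_Mapping.single (Word ls) (c :: 'k) * gen x"
  by (simp add: gen_def mult_single plus_word_def)

lemma single_letter: "Poly_Mapping.single (Word [x]) c = Poly_Mapping.single 0 (c :: 'k) * gen x"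
  by (simp add: gen_def mult_single)

lemma single_word_in_F [simp]:
  "ls \<noteq> [] \<Longrightarrow> set ls \<subseteq> lpa_gens \<E> \<Longrightarrow> Poly_Mapping.single (Word ls) c \<in> carrier F"
  by (simp add: single_in_free_algebra)

lemma cl_unit:
  assumes "f \<in> carrier F"
  shows "cl (unit * f) = cl f" "cl (f * unit) = cl f"
proof -
  have gen: "unit * gen x - gen x \<in> I" "gen x * unit - gen x \<in> I" if "x \<in> lpa_gens \<E>" for x
    using unit_gen[OF that] by (simp_all add: cl_eq_iff)
  have "unit * f - f \<in> I \<and> f * unit - f \<in> I"
  proof (induction f rule: poly_mapping_single_induct)
    case (add f g)
    then have "unit * f - f + (unit * g - g) \<in> I" "f * unit - f + (g * unit - g) \<in> I"
      by (auto intro: I_add)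
    then show ?case by (simp add: algebra_simps)
  next
    case (single w c)
    obtain ls where w: "w = Word ls" by (cases w)
    with single assms have ls: "ls \<noteq> []" "set ls \<subseteq> lpa_gens \<E>" by (fastforce simp: free_algebra_carrier_iff)+
    have letter: "unit * Poly_Mapping.single (Word [x]) c - Poly_Mapping.single (Word [x]) c \<in> I"
      "Poly_Mapping.single (Word [x]) c * unit - Poly_Mapping.single (Word [x]) c \<in> I"
      if "x \<in> lpa_gens \<E>" for x
    proof -
      have "unit * (Poly_Mapping.single 0 c * gen x) = Poly_Mapping.single 0 c * (unit * gen x)"
        by (metis mult.assoc scale_commute)
      then show "unit * Poly_Mapping.single (Word [x]) c - Poly_Mapping.single (Word [x]) c \<in> I"
        "Poly_Mapping.single (Word [x]) c * unit - Poly_Mapping.single (Word [x]) c \<in> I"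
        using I_scale[OF gen(1)[OF that], of c] I_scale[OF gen(2)[OF that], of c]
        by (simp_all add: single_letter right_diff_distrib mult.assoc)
    qed
    obtain x ms where l: "ls = x # ms" using ls by (cases ls) auto
    have "unit * Poly_Mapping.single w c - Poly_Mapping.single w c \<in> I"
    \<comment> \<open>Only the first letter meets the unit. Words of one letter are separate because
      the remaining factor would be the empty word, a constant outside the free algebra without
      unit.\<close>
    proof (cases "ms = []")
      case False
      then have "(unit * gen x - gen x) * Poly_Mapping.single (Word ms) c \<in> I"
        using ls l gen(1) by (intro I_mult_right) auto
      then show ?thesis by (simp add: w l single_Cons left_diff_distrib mult.assoc)
    qed (use w l ls letter(1) in auto)
    moreover obtain y ns where r: "ls = ns @ [y]" using ls by (cases ls rule: rev_cases) auto
    have "Poly_Mapping.single w c * unit - Poly_Mapping.single w c \<in> I"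
    proof (cases "ns = []")
      case False
      then have "Poly_Mapping.single (Word ns) c * (gen y * unit - gen y) \<in> I"
        using ls r gen(2) by (intro I_mult_left) auto
      then show ?thesis by (simp add: w r single_snoc right_diff_distrib mult.assoc)
    qed (use w r ls letter(2) in auto)
    ultimately show ?case by simp
  qed simp
  then show "cl (unit * f) = cl f" "cl (f * unit) = cl f" by (simp_all add: cl_eq_iff)
qed

lemma abelian_group_L: "abelian_group L"
proof (rule abelian_groupI)
  fix x assume "x \<in> carrier L"
  then obtain f where f: "f \<in> carrier F" "x = cl f" by (auto simp: L_carrier)
  then show "\<exists>y\<in>carrier L. y \<oplus>\<^bsub>L\<^esub> x = \<zero>\<^bsub>L\<^esub>"
    by (intro bexI[of _ "cl (- f)"]) (auto simp: L_carrier L_zero)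
qed (auto simp: L_carrier L_zero algebra_simps)

lemma ring_L: "ring L"
proof (rule ringI[OF abelian_group_L])
  show "monoid L"
    by (rule monoidI) (auto simp: L_carrier L_one cl_unit mult.assoc)
qed (auto simp: L_carrier algebra_simps)

lemma module_L: "module field_ring L"
  by (rule moduleI[OF cring_field_ring abelian_group_L])
    (auto simp: L_carrier algebra_simps single_add scale_scale)

sublocale L: ring L
  by (rule ring_L)

lemma cl_closed [simp]: "f \<in> carrier F \<Longrightarrow> cl f \<in> carrier L"
  by (simp add: L_carrier)

lemma L_uminus [simp]: "f \<in> carrier F \<Longrightarrow> \<ominus>\<^bsub>L\<^esub> cl f = cl (- f)"
  by (rule L.minus_equality) (simp_all add: L_zero)

sublocale representation: labeled_representation \<E> L
  "\<lambda>A. cl (gen (Proj A))" "\<lambda>a. cl (gen (Edge a))" "\<lambda>a. cl (gen (Ghost a))"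
proof (intro labeled_representation.intro labeled_representation_axioms.intro ring_L module_L
    normal_labeled_space_axioms)
  fix x y c assume xy: "x \<in> carrier L" "y \<in> carrier L"
  then obtain f g where fg: "f \<in> carrier F" "g \<in> carrier F" "x = cl f" "y = cl g" by (auto simp: L_carrier)
  then show "(c \<odot>\<^bsub>L\<^esub> x) \<otimes>\<^bsub>L\<^esub> y = c \<odot>\<^bsub>L\<^esub> (x \<otimes>\<^bsub>L\<^esub> y)" by (simp add: mult.assoc)
  have "f * (Poly_Mapping.single 0 c * g) = Poly_Mapping.single 0 c * (f * g)"
    by (metis mult.assoc scale_commute)
  then show "x \<otimes>\<^bsub>L\<^esub> (c \<odot>\<^bsub>L\<^esub> y) = c \<odot>\<^bsub>L\<^esub> (x \<otimes>\<^bsub>L\<^esub> y)" using fg by simp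
next
  fix A B assume AB: "A \<in> family \<E>" "B \<in> family \<E>"
  then show "cl (gen (Proj (A \<inter> B))) = cl (gen (Proj A)) \<otimes>\<^bsub>L\<^esub> cl (gen (Proj B))"
    by (simp add: cl_proj_Int)
  show "cl (gen (Proj (A \<union> B))) = cl (gen (Proj A)) \<oplus>\<^bsub>L\<^esub> cl (gen (Proj B)) \<ominus>\<^bsub>L\<^esub> cl (gen (Proj (A \<inter> B)))"
    using AB cl_relation[OF lpa_relations.proj_Un[OF AB]] by (simp add: a_minus_def family_Int)
next
  show "cl (gen (Proj {})) = \<zero>\<^bsub>L\<^esub>"
    by (simp add: L_zero cl_eq_iff relation_in_I lpa_relations.proj_empty)
next
  fix a b assume "a \<in> alphabet \<E>" "b \<in> alphabet \<E>" "b \<noteq> a"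
  then show "cl (gen (Ghost b)) \<otimes>\<^bsub>L\<^esub> cl (gen (Edge a)) = \<zero>\<^bsub>L\<^esub>"
    by (simp add: L_zero cl_eq_iff relation_in_I lpa_relations.ghost_edge_neq)
next
  fix a assume "a \<in> alphabet \<E>"
  then show "cl (gen (Ghost a)) \<otimes>\<^bsub>L\<^esub> cl (gen (Edge a)) \<otimes>\<^bsub>L\<^esub> cl (gen (Ghost a)) = cl (gen (Ghost a))"
    using cl_ghost_edge_ghost by simp
qed (simp_all add: cl_proj_edge cl_ghost_proj cl_ghost_edge cl_edge_ghost_edge
    L_one rel_range_family word_range_family)

section \<open>Homogeneous components and the direct sum decomposition\<close>

lemma lpa_monomial_eq: "lpa_monomial \<E> = representation.monomial"
  by (simp add: fun_eq_iff lpa_monomial_def representation.monomial_def)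

text \<open>Starting from the unit of the quotient gives the empty word a value, although the free
  algebra lacks it; inductions on words can then begin there.\<close>

definition word_class :: "('v, 'a) lpa_gen list \<Rightarrow> (('v, 'a) lpa_gen word \<Rightarrow>\<^sub>0 'k) set" where
  "word_class ls = foldr (\<lambda>x y. cl (gen x) \<otimes>\<^bsub>L\<^esub> y) ls \<one>\<^bsub>L\<^esub>"

lemma cl_single_word:
  "ls \<noteq> [] \<Longrightarrow> set ls \<subseteq> lpa_gens \<E> \<Longrightarrow> cl (Poly_Mapping.single (Word ls) 1) = word_class ls"
proof (induction ls)
  case (Cons x ls)
  show ?case
  proof (cases "ls = []")
    case True
    then show ?thesis using Cons.prems by (simp add: word_class_def flip: gen_def)
  next
    case False
    have "cl (Poly_Mapping.single (Word (x # ls)) 1) = cl (gen x) \<otimes>\<^bsub>L\<^esub> cl (Poly_Mapping.single (Word ls) 1)"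
      using False Cons.prems by (simp add: single_Cons)
    then show ?thesis using False Cons by (simp add: word_class_def)
  qed
qed simp

text \<open>The word is built up from its right end: a generator multiplied from the left turns a
  monomial into a monomial or into zero.\<close>

lemma word_class_monomial:
  "set ls \<subseteq> lpa_gens \<E> \<Longrightarrow>
    word_class ls \<in> insert \<zero>\<^bsub>L\<^esub> (representation.monomials (sum_list (map gen_degree ls)))"
proof (induction ls)
  case Nil
  have "\<one>\<^bsub>L\<^esub> = representation.monomial [] (verts (digraph_of \<E>)) []"
    by (simp add: representation.monomial_def L_one)
  moreover have "representation.monomial [] (verts (digraph_of \<E>)) [] \<in> representation.monomials 0"
    unfolding representation.monomials_def mem_Collect_eq
    by (intro exI[of _ "[]"] exI[of _ "verts (digraph_of \<E>)"] conjI refl) (simp_all add: verts_family)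
  ultimately show ?case by (simp add: word_class_def)
next
  case (Cons x ls)
  let ?n = "sum_list (map gen_degree ls)"
  have *: "word_class (z # ls) = cl (gen z) \<otimes>\<^bsub>L\<^esub> word_class ls" for z by (simp add: word_class_def)
  have x: "x \<in> lpa_gens \<E>" using Cons.prems by simp
  have IH: "word_class ls \<in> insert \<zero>\<^bsub>L\<^esub> (representation.monomials ?n)" using Cons by simp
  show ?case
  proof (cases "word_class ls = \<zero>\<^bsub>L\<^esub>")
    case True
    then show ?thesis using x by (simp add: *)
  next
    case False
    then have m: "word_class ls \<in> representation.monomials ?n" using IH by simp
    show ?thesis
    proof (cases x)
      case (Proj A)
      then show ?thesis using x representation.P_mult_monomials[OF m] by (simp add: *)
    next
      case (Edge a)
      then show ?thesis using x representation.S_mult_monomials[OF m] by (simp add: *)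
    next
      case (Ghost a)
      then show ?thesis using x representation.T_mult_monomials[OF m] by (simp add: *)
    qed
  qed
qed

lemma labeled_word_alphabet: "\<alpha> \<in> labeled_words \<E> \<Longrightarrow> set \<alpha> \<subseteq> alphabet \<E>"
  unfolding labeling_surj[symmetric]
  by (auto simp: labeled_words_def labeled_words1_def pre_digraph.awalk_def) blast

lemma LPA_component_eq_span: "LPA_component \<E> n = lin_span L (representation.monomials n)"
proof -
  let ?M = "{lpa_monomial \<E> \<alpha> A \<beta> | \<alpha> A \<beta>. \<alpha> \<in> labeled_words \<E> \<and> \<beta> \<in> labeled_words \<E> \<and>
    A \<in> family_below \<E> \<alpha> \<inter> family_below \<E> \<beta> \<and> int (length \<alpha>) - int (length \<beta>) = n} ::
      (('v, 'a) lpa_gen word \<Rightarrow>\<^sub>0 'k) set set"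
  have sub: "?M \<subseteq> representation.monomials n"
  proof
    fix x assume "x \<in> ?M"
    then obtain \<alpha> A \<beta> where x: "x = lpa_monomial \<E> \<alpha> A \<beta>" "\<alpha> \<in> labeled_words \<E>" "\<beta> \<in> labeled_words \<E>"
        "A \<in> family_below \<E> \<alpha> \<inter> family_below \<E> \<beta>" "int (length \<alpha>) - int (length \<beta>) = n"
      by blast
    then have "set \<alpha> \<subseteq> alphabet \<E>" "set \<beta> \<subseteq> alphabet \<E>" "A \<in> family \<E>"
      using labeled_word_alphabet by (simp_all add: family_below_def)
    then show "x \<in> representation.monomials n"
      unfolding representation.monomials_def using x(1,5) lpa_monomial_eq by auto
  qed
  have span: "submodule (lin_span L (representation.monomials n)) field_ring L" "submodule (lin_span L ?M) field_ring L"
    by (rule submodule_lin_span[OF module_L], use sub representation.monomials_closed[of n] in simp)+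
  have "\<zero>\<^bsub>L\<^esub> \<in> lin_span L ?M"
    by (rule additive_subgroup.zero_closed[OF submodule_additive_subgroup[OF span(2)]])
  then have "insert \<zero>\<^bsub>L\<^esub> ?M \<subseteq> lin_span L ?M"
    using lin_span_base[of ?M L] by simp
  moreover have "representation.monomials n \<subseteq> insert \<zero>\<^bsub>L\<^esub> ?M"
    using representation.monomials_reduced[of n] by (simp only: lpa_monomial_eq)
  ultimately have "representation.monomials n \<subseteq> lin_span L ?M" by (rule subset_trans[rotated])
  moreover have "?M \<subseteq> lin_span L (representation.monomials n)"
    using sub lin_span_base by (rule subset_trans)
  ultimately have "lin_span L ?M = lin_span L (representation.monomials n)"
    using span by (intro equalityI lin_span_least)
  then show ?thesis by (simp add: LPA_component_def)
qed

lemma submodule_component: "submodule (LPA_component \<E> n) field_ring L"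
  unfolding LPA_component_eq_span by (rule submodule_lin_span[OF module_L representation.monomials_closed])

text \<open>The folds defining the monomial are repeated on representatives, each ghost edge
  lowering and each edge raising the degree by one.\<close>

lemma homogeneous_monomial:
  assumes "x \<in> representation.monomials n"
  shows "\<exists>f\<in>carrier F. homogeneous n f \<and> x = cl f"
proof -
  obtain \<alpha> A \<beta> where *: "set \<alpha> \<subseteq> alphabet \<E>" "set \<beta> \<subseteq> alphabet \<E>" "A \<in> family \<E>"
      "int (length \<alpha>) - int (length \<beta>) = n" "x = representation.monomial \<alpha> A \<beta>"
    using assms by (auto simp: representation.monomials_def)
  have "\<exists>f\<in>carrier F. homogeneous (- int (length \<beta>)) f \<and> foldr (\<lambda>b x. x \<otimes>\<^bsub>L\<^esub> cl (gen (Ghost b))) \<beta> (cl (gen (Proj A))) = cl f"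
    using *(2)
  proof (induction \<beta>)
    case Nil
    then show ?case using *(3) homogeneous_gen[of "Proj A"] by (intro bexI[of _ "gen (Proj A)"]) auto
  next
    case (Cons b \<beta>)
    then obtain f where f: "f \<in> carrier F" "homogeneous (- int (length \<beta>)) f"
        "foldr (\<lambda>b x. x \<otimes>\<^bsub>L\<^esub> cl (gen (Ghost b))) \<beta> (cl (gen (Proj A))) = cl f" by auto
    have "homogeneous (- int (length (b # \<beta>))) (f * gen (Ghost b))"
      using homogeneous_mult[OF f(2) homogeneous_gen[of "Ghost b"]] by (simp add: algebra_simps)
    then show ?case using f Cons.prems by (intro bexI[of _ "f * gen (Ghost b)"]) auto
  qed
  then obtain g where g: "g \<in> carrier F" "homogeneous (- int (length \<beta>)) g"
      "foldr (\<lambda>b x. x \<otimes>\<^bsub>L\<^esub> cl (gen (Ghost b))) \<beta> (cl (gen (Proj A))) = cl g" by auto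
  have "\<exists>f\<in>carrier F. homogeneous (int (length \<alpha>) - int (length \<beta>)) f \<and> representation.monomial \<alpha> A \<beta> = cl f"
    using *(1)
  proof (induction \<alpha>)
    case Nil
    then show ?case using g by (auto simp: representation.monomial_def)
  next
    case (Cons a \<alpha>)
    then obtain f where f: "f \<in> carrier F" "homogeneous (int (length \<alpha>) - int (length \<beta>)) f"
        "representation.monomial \<alpha> A \<beta> = cl f" by auto
    have "homogeneous (int (length (a # \<alpha>)) - int (length \<beta>)) (gen (Edge a) * f)"
      using homogeneous_mult[OF homogeneous_gen[of "Edge a"] f(2)] by (simp add: algebra_simps)
    then show ?case using f Cons.prems
      by (intro bexI[of _ "gen (Edge a) * f"]) (auto simp: representation.monomial_Cons_left)
  qed
  then show ?thesis using * by simp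
qed

text \<open>Regularity needs a component as a span of monomials. For products and the direct sum
  this second description is used, which moves the question to the free algebra.\<close>

lemma LPA_component_eq: "LPA_component \<E> n = cl ` {f \<in> carrier F. homogeneous n f}"
proof
  interpret M: module field_ring L by (rule module_L)
  have "submodule (cl ` {f \<in> carrier F. homogeneous n f}) field_ring L"
    by (rule M.submoduleI)
      (auto simp: L_zero homogeneous_add homogeneous_scale simp flip: scale_uminus intro!: imageI)
  moreover have "representation.monomials n \<subseteq> cl ` {f \<in> carrier F. homogeneous n f}"
    using homogeneous_monomial by blast
  ultimately show "LPA_component \<E> n \<subseteq> cl ` {f \<in> carrier F. homogeneous n f}"
    unfolding LPA_component_eq_span by (rule lin_span_least)
next
  show "cl ` {f \<in> carrier F. homogeneous n f} \<subseteq> LPA_component \<E> n"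
  proof safe
    fix f assume f: "f \<in> carrier F" "homogeneous n f"
    interpret M: module field_ring L by (rule module_L)
    note E = M.submoduleE(4,5)[OF submodule_component, simplified]
    have zero: "\<zero>\<^bsub>L\<^esub> \<in> LPA_component \<E> n"
      by (rule additive_subgroup.zero_closed[OF submodule_additive_subgroup[OF submodule_component]])
    show "cl f \<in> LPA_component \<E> n"
    proof (induction f rule: poly_mapping_single_induct)
      case zero
      then show ?case using \<open>\<zero>\<^bsub>L\<^esub> \<in> LPA_component \<E> n\<close> by (simp add: L_zero)
    next
      case (add f g)
      then show ?case using E(2)[of "cl f" n "cl g"] by simp
    next
      case (single w c)
      obtain ls where w: "w = Word ls" by (cases w)
      with single f have ls: "ls \<noteq> []" "set ls \<subseteq> lpa_gens \<E>" "sum_list (map gen_degree ls) = n"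
        by (fastforce simp: free_algebra_carrier_iff homogeneous_def word_degree_def)+
      have "cl (Poly_Mapping.single w 1) \<in> insert \<zero>\<^bsub>L\<^esub> (representation.monomials n)"
        using cl_single_word[OF ls(1,2)] word_class_monomial[OF ls(2)] ls(3) w by simp
      then have "cl (Poly_Mapping.single w 1) \<in> LPA_component \<E> n"
        using zero lin_span_base[of "representation.monomials n" L] by (auto simp: LPA_component_eq_span)
      then have "c \<odot>\<^bsub>L\<^esub> cl (Poly_Mapping.single w 1) \<in> LPA_component \<E> n" by (rule E(1))
      then show ?case by (simp add: mult_single)
    qed
  qed
qed

lemma finsum_L:
  "(\<And>i. i \<in> A \<Longrightarrow> f i \<in> carrier F) \<Longrightarrow> finite A \<Longrightarrow> (\<Oplus>\<^bsub>L\<^esub>i\<in>A. cl (f i)) = cl (sum f A)"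
proof (induction A rule: infinite_finite_induct)
  case (insert a A)
  then show ?case by (subst L.finsum_insert) auto
qed (simp_all add: L_zero)

text \<open>Existence comes from the homogeneous parts of any representative. For uniqueness,
  homogeneous lifts of another decomposition add up to a polynomial differing from f by an element
  of \<open>I\<close>, and \<open>I\<close> contains the homogeneous parts of that
  difference.\<close>

lemma component_decomposition:
  assumes x: "x \<in> carrier L"
  shows "\<exists>!f. (\<forall>n. f n \<in> LPA_component \<E> n) \<and> finite {n. f n \<noteq> \<zero>\<^bsub>L\<^esub>} \<and>
    x = (\<Oplus>\<^bsub>L\<^esub>n\<in>{n. f n \<noteq> \<zero>\<^bsub>L\<^esub>}. f n)"
proof -
  obtain f where f: "f \<in> carrier F" "x = cl f" using x by (auto simp: L_carrier)
  let ?h = "\<lambda>n. hom_part word_degree n f" and ?N = "word_degree ` Poly_Mapping.keys f"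
  define g where "g n = cl (?h n)" for n
  have supp: "{n. g n \<noteq> \<zero>\<^bsub>L\<^esub>} \<subseteq> ?N"
  proof
    fix n assume n: "n \<in> {n. g n \<noteq> \<zero>\<^bsub>L\<^esub>}"
    then have "?h n \<noteq> 0" by (auto simp: g_def L_zero)
    then obtain w where "w \<in> Poly_Mapping.keys (?h n)" by (metis keys_eq_empty ex_in_conv)
    then show "n \<in> ?N" by (auto simp: keys_hom_part)
  qed
  have fin: "finite {n. g n \<noteq> \<zero>\<^bsub>L\<^esub>}" by (rule finite_subset[OF supp]) simp
  have g_comp: "g n \<in> LPA_component \<E> n" for n
    using f by (auto simp: g_def LPA_component_eq hom_part_in_free_algebra homogeneous_hom_part)
  have "(\<Oplus>\<^bsub>L\<^esub>n\<in>{n. g n \<noteq> \<zero>\<^bsub>L\<^esub>}. g n) = (\<Oplus>\<^bsub>L\<^esub>n\<in>?N. g n)"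
    by (rule L.add.finprod_mono_neutral_cong_left)
      (use supp f in \<open>auto simp: g_def hom_part_in_free_algebra\<close>)
  also have "\<dots> = cl (\<Sum>n\<in>?N. ?h n)"
    unfolding g_def by (rule finsum_L) (use f in \<open>auto simp: hom_part_in_free_algebra\<close>)
  also have "\<dots> = x" using sum_hom_part[of ?N word_degree f] f by simp
  finally have g_sum: "x = (\<Oplus>\<^bsub>L\<^esub>n\<in>{n. g n \<noteq> \<zero>\<^bsub>L\<^esub>}. g n)" ..
  show ?thesis
  proof (rule ex1I[of _ g])
    show "(\<forall>n. g n \<in> LPA_component \<E> n) \<and> finite {n. g n \<noteq> \<zero>\<^bsub>L\<^esub>} \<and>
        x = (\<Oplus>\<^bsub>L\<^esub>n\<in>{n. g n \<noteq> \<zero>\<^bsub>L\<^esub>}. g n)"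
      using g_comp fin g_sum by blast
  next
    fix g' assume g': "(\<forall>n. g' n \<in> LPA_component \<E> n) \<and> finite {n. g' n \<noteq> \<zero>\<^bsub>L\<^esub>} \<and>
        x = (\<Oplus>\<^bsub>L\<^esub>n\<in>{n. g' n \<noteq> \<zero>\<^bsub>L\<^esub>}. g' n)"
    let ?S = "{n. g' n \<noteq> \<zero>\<^bsub>L\<^esub>}"
    have "\<forall>n. \<exists>q. q \<in> carrier F \<and> homogeneous n q \<and> g' n = cl q"
      using g' by (auto simp: LPA_component_eq)
    then obtain q where q: "\<And>n. q n \<in> carrier F" "\<And>n. homogeneous n (q n)" "\<And>n. g' n = cl (q n)" by metis
    have "cl f = (\<Oplus>\<^bsub>L\<^esub>n\<in>?S. cl (q n))" using g' f q(3) by simp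
    also have "\<dots> = cl (\<Sum>n\<in>?S. q n)" by (rule finsum_L) (use q g' in auto)
    finally have diff: "f - (\<Sum>n\<in>?S. q n) \<in> I" by (simp add: cl_eq_iff)
    show "g' = g"
    proof
      fix m
      have "hom_part word_degree m (\<Sum>n\<in>?S. q n) = (\<Sum>n\<in>?S. if m = n then q n else 0)"
        unfolding hom_part_sum using q(2)
        by (intro sum.cong refl hom_part_homogeneous) (simp add: homogeneous_def)
      also have "\<dots> = (if m \<in> ?S then q m else 0)"
        using g' by (subst sum.delta') auto
      finally have "cl (?h m) = cl (if m \<in> ?S then q m else 0)"
        using hom_part_ideal[OF diff, of m] by (simp add: cl_eq_iff hom_part_diff)
      also have "\<dots> = g' m" by (cases "m \<in> ?S") (auto simp: q(3) L_zero)
      finally show "g' m = g m" by (simp add: g_def)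
    qed
  qed
qed

end

theorem theorem5p13:
  fixes \<E> :: "('v, 'e, 'a) labeled_space"
  assumes "normal_labeled_space \<E>"
  shows "graded_regular_ring
    (LPA \<E> :: ('k::field, (('v, 'a) lpa_gen word \<Rightarrow>\<^sub>0 'k) set) module) (LPA_component \<E>)"
proof -
  interpret leavitt_labeled_path_algebra \<E> "TYPE('k)"
    by (rule leavitt_labeled_path_algebra.intro) fact
  show ?thesis
  proof (intro graded_regular_ring.intro graded_ring.intro graded_ring_axioms.intro
      graded_regular_ring_axioms.intro ring_L)
    show "additive_subgroup (LPA_component \<E> n) L" for n
      by (rule submodule_additive_subgroup[OF submodule_component])
  next
    fix x y :: "(('v, 'a) lpa_gen word \<Rightarrow>\<^sub>0 'k) set" and m n
    assume "x \<in> LPA_component \<E> m" "y \<in> LPA_component \<E> n"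
    then show "x \<otimes>\<^bsub>L\<^esub> y \<in> LPA_component \<E> (m + n)"
      by (auto simp: LPA_component_eq homogeneous_mult)
  next
    fix x :: "(('v, 'a) lpa_gen word \<Rightarrow>\<^sub>0 'k) set" and n
    assume "x \<in> LPA_component \<E> n"
    then show "\<exists>y\<in>carrier L. x \<otimes>\<^bsub>L\<^esub> y \<otimes>\<^bsub>L\<^esub> x = x"
      unfolding LPA_component_eq_span by (rule representation.monomials_span_regular)
  qed (rule component_decomposition)
qed

end
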